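(* Let $\mathcal{H}$ be a Hilbert space and $\mathcal{G}$ a normed space. Let $I=\{1,\dots,m\}$, $I_0=\{m+1,\dots,n\}$ (possibly $I_0=\emptyset$), and let $h_i:\mathcal{G}\times\mathcal{H}\to\mathbb{R}$, $i=1,\dots,n$, be jointly continuous functions whose partial gradients $\nabla_x h_i$ are jointly continuous. Define $F(p)=\{x\in\mathcal{H}\mid h_i(p,x)\le 0,\ i\in I,\ h_i(p,x)=0,\ i\in I_0\}$ and let $(p^0,x^0)\in\mathrm{gr}F$. Assume: 1) $F$ is lower semicontinuous at $(p^0,x^0)$ relative to $\mathrm{dom}F$; 2) $F$ satisfies RCRCQ at $(p^0,x^0)$ relative to $\mathrm{dom}F\times\mathcal{H}$. Then $F$ is R-regular at $(p^0,x^0)$ relative to $\mathrm{dom}F$.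
   Context: $\mathrm{dom}F=\{p\mid F(p)\neq\emptyset\}$, $\mathrm{gr}F=\{(p,x)\mid x\in F(p)\}$. $F$ is lower semicontinuous at $(p^0,x^0)$ relative to $P$ if for every neighbourhood $V(x^0)$ there is a neighbourhood $V(p^0)$ with $F(p)\cap V(x^0)\neq\emptyset$ for all $p\in V(p^0)\cap P$. Let $I(p,x)=\{i\in I\mid h_i(p,x)=0\}$. $F$ satisfies RCRCQ at $(p^0,x^0)$ relative to $P\times X$ if for every $K\subset I(p^0,x^0)$, $\mathrm{rank}\{\nabla_x h_i(p,x): i\in I_0\cup K\}=\mathrm{rank}\{\nabla_x h_i(p^0,x^0): i\in I_0\cup K\}$ for all $(p,x)\in P\times X$ in some neighbourhood of $(p^0,x^0)$. $F$ is R-regular at $(p^0,x^0)$ relative to $P$ if there exist $M>0$ and neighbourhoods $V(p^0)$, $V(x^0)$ such that $\mathrm{dist}(x,F(p))\le M\max\{0,\ h_i(p,x)\ (i\in I),\ |h_i(p,x)|\ (i\in I_0)\}$ for all $x\in V(x^0)$ and $p\in V(p^0)\cap P$. *)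

theory Defs
  imports "HOL-Analysis.Analysis"
begin

definition ineqI :: "nat \<Rightarrow> nat set" where
  "ineqI m = {1..m}"

definition eqI0 :: "nat \<Rightarrow> nat \<Rightarrow> nat set" where
  "eqI0 m n = {m+1..n}"

definition feas :: "(nat \<Rightarrow> 'p \<Rightarrow> 'x \<Rightarrow> real) \<Rightarrow> nat \<Rightarrow> nat \<Rightarrow> 'p \<Rightarrow> 'x set" where
  "feas h m n p = {x. (\<forall>i\<in>ineqI m. h i p x \<le> 0) \<and> (\<forall>i\<in>eqI0 m n. h i p x = 0)}"

definition dom_sv :: "('p \<Rightarrow> 'x set) \<Rightarrow> 'p set" where
  "dom_sv F = {p. F p \<noteq> {}}"

definition graph_sv :: "('p \<Rightarrow> 'x set) \<Rightarrow> ('p \<times> 'x) set" where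
  "graph_sv F = {(p, x). x \<in> F p}"

definition lsc_rel :: "('p::topological_space \<Rightarrow> 'x::topological_space set) \<Rightarrow> 'p set \<Rightarrow> 'p \<Rightarrow> 'x \<Rightarrow> bool" where
  "lsc_rel F P p0 x0 \<longleftrightarrow>
     (\<forall>V. open V \<and> x0 \<in> V \<longrightarrow>
        (\<exists>W. open W \<and> p0 \<in> W \<and> (\<forall>p\<in>W \<inter> P. F p \<inter> V \<noteq> {})))"

definition active :: "(nat \<Rightarrow> 'p \<Rightarrow> 'x \<Rightarrow> real) \<Rightarrow> nat \<Rightarrow> 'p \<Rightarrow> 'x \<Rightarrow> nat set" where
  "active h m p x = {i\<in>ineqI m. h i p x = 0}"

definition rank_fam :: "(nat \<Rightarrow> 'x::real_vector) \<Rightarrow> nat set \<Rightarrow> nat" where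
  "rank_fam v J = dim (v ` J)"

text \<open>Relaxed constant rank constraint qualification at (p0,x0) relative to P \<times> X,
  where gh i p x is the partial gradient of h i with respect to x.\<close>
definition RCRCQ :: "(nat \<Rightarrow> 'p::topological_space \<Rightarrow> 'x::{topological_space,real_vector} \<Rightarrow> real) \<Rightarrow>
    (nat \<Rightarrow> 'p \<Rightarrow> 'x \<Rightarrow> 'x) \<Rightarrow> nat \<Rightarrow> nat \<Rightarrow> 'p set \<Rightarrow> 'x set \<Rightarrow> 'p \<Rightarrow> 'x \<Rightarrow> bool" where
  "RCRCQ h gh m n P X p0 x0 \<longleftrightarrow>
     (\<forall>K. K \<subseteq> active h m p0 x0 \<longrightarrow>
        (\<exists>U. open U \<and> (p0, x0) \<in> U \<and>
           (\<forall>(p, x)\<in>U \<inter> (P \<times> X).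
              rank_fam (\<lambda>i. gh i p x) (eqI0 m n \<union> K) = rank_fam (\<lambda>i. gh i p0 x0) (eqI0 m n \<union> K))))"

definition resid :: "(nat \<Rightarrow> 'p \<Rightarrow> 'x \<Rightarrow> real) \<Rightarrow> nat \<Rightarrow> nat \<Rightarrow> 'p \<Rightarrow> 'x \<Rightarrow> real" where
  "resid h m n p x = Max ({0} \<union> (\<lambda>i. h i p x) ` ineqI m \<union> (\<lambda>i. \<bar>h i p x\<bar>) ` eqI0 m n)"

definition R_regular :: "(nat \<Rightarrow> 'p::topological_space \<Rightarrow> 'x::metric_space \<Rightarrow> real) \<Rightarrow> nat \<Rightarrow> nat \<Rightarrow> 'p set \<Rightarrow> 'p \<Rightarrow> 'x \<Rightarrow> bool" where
  "R_regular h m n P p0 x0 \<longleftrightarrow>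
     (\<exists>M>0. \<exists>Vp Vx. open Vp \<and> p0 \<in> Vp \<and> open Vx \<and> x0 \<in> Vx \<and>
        (\<forall>x\<in>Vx. \<forall>p\<in>Vp \<inter> P. infdist x (feas h m n p) \<le> M * resid h m n p x))"

end

theory Submission
  imports Defs
begin

text \<open>
  Pick a maximal subset J of the equality constraints with independent gradients at the reference point. Near that
  point F(p) is the zero set of the merit function f_p = max(0, h_i (i active), N |h_j| (j in J)), since
  by constant rank the remaining equalities are functions of those in J. If the active pieces of
  f_p at x have a common descent direction at the reference point, then f_p decreases at x at a uniform
  rate. Otherwise some active inequality gradients form a circuit with positive weights modulo the
  gradients in J. By constant rank one inequality of the circuit is then locally a function of the others
  and of the h_j, decreasing in the others. Compared with a feasible point near the reference point, which
  exists by lower semicontinuity, all of them being equal to f_p(x) > 0 is impossible once N is large.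
  So the uniform decrease holds wherever f_p > 0, and an Ekeland-type argument gives the error bound.
  Projections onto F(p), which may fail to exist in infinite dimension, are not involved.
\<close>

section \<open>Error bounds from uniform decrease\<close>

text \<open>The obstacle is that the constraints are differentiable in \<open>x\<close> only and the
  parameters range over a set without structure, so an implicit function theorem in
  \<open>(p, x)\<close> cannot eliminate redundant constraints. Dependence is therefore expressed by
  increments between two points at the same \<open>p\<close>, with a radius uniform in
  \<open>p\<close> and coefficients close to those of the linear relation at the reference point;
  closeness preserves the signs in a circuit. Since RCRCQ holds near the reference point for all
  \<open>x\<close>, the path joining the two points may cross infeasible points. Increments ignore
  offsets depending on \<open>p\<close>, as in \<open>h_2 = p - h_1\<close>; a feasible point
  controls the offset, and it must be near \<open>x0\<close> because dependence is local.
  Restricting the equality pieces to \<open>J\<close> matters: independence excludes that the pieces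
  \<open>N * h_j\<close> and \<open>- N * h_j\<close> alone block every descent direction. The
  constants are not circular: \<open>N\<close> depends on the circuit factor, the rate
  \<open>c\<close> on the pieces weighted by \<open>N\<close>, and the neighbourhoods on
  \<open>c\<close>.\<close>

lemma decrease_condition_imp_zero:
  fixes f :: "'a::complete_space \<Rightarrow> real"
  assumes cont: "continuous_on UNIV f" and nonneg: "\<And>u. 0 \<le> f u" and c: "0 < c"
    and step: "\<And>u. dist x u \<le> f x / c \<Longrightarrow> 0 < f u \<Longrightarrow> \<exists>v. v \<noteq> u \<and> f v + c * dist u v \<le> f u"
  shows "\<exists>z. f z = 0 \<and> dist x z \<le> f x / c"
proof -
  \<comment> \<open>\<open>S u\<close> is the lower section of \<open>u\<close> in Ekeland's order:
    the points whose decrease of \<open>f\<close> pays for the distance at rate \<open>c\<close>.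
    The limit \<open>z\<close> below is minimal in this order unless \<open>f z = 0\<close>; it lies
    within \<open>f x / c\<close> of \<open>x\<close>, which is why \<open>step\<close> is asked
    only there.\<close>
  define S where "S u = {v. f v + c * dist u v \<le> f u}" for u
  have S_refl: "u \<in> S u" for u by (simp add: S_def)
  have S_trans: "w \<in> S u" if "v \<in> S u" "w \<in> S v" for u v w
  proof -
    have "c * dist u w \<le> c * dist u v + c * dist v w"
      using dist_triangle[of u w v] c by (simp add: ring_distribs[symmetric])
    then show ?thesis using that by (simp add: S_def)
  qed
  \<comment> \<open>The infimum over \<open>S u\<close> need not be attained, so it is approached up
    to a tolerance that tends to 0.\<close>
  have "\<exists>v\<in>S u. \<forall>w\<in>S u. f v \<le> f w + (1/2)^k" for u and k :: nat
  proof -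
    have bdd: "bdd_below (f ` S u)" using nonneg by (intro bdd_belowI[of _ 0]) auto
    have "Inf (f ` S u) < Inf (f ` S u) + (1/2)^k" by simp
    then obtain v where v: "v \<in> S u" "f v < Inf (f ` S u) + (1/2)^k"
      using S_refl[of u] by (subst (asm) cInf_less_iff[OF _ bdd]) auto
    have "Inf (f ` S u) \<le> f w" if "w \<in> S u" for w
      using that by (intro cInf_lower[OF _ bdd]) auto
    then have "f v \<le> f w + (1/2)^k" if "w \<in> S u" for w using v(2) that by (metis add_le_cancel_right less_imp_le order_trans)
    then show ?thesis using v(1) by blast
  qed
  then obtain nxt where nxt: "\<And>u k. nxt u k \<in> S u"
      "\<And>u k w. w \<in> S u \<Longrightarrow> f (nxt u k) \<le> f w + (1/2)^k" for u and k :: nat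
    by metis
  define s where "s = rec_nat x (\<lambda>k u. nxt u k)"
  have s0: "s 0 = x" and sSuc: "s (Suc k) = nxt (s k) k" for k by (simp_all add: s_def)
  have sS: "s j \<in> S (s i)" if "i \<le> j" for i j
    using that by (induction rule: dec_induct) (auto simp: sSuc S_refl intro: S_trans nxt)
  have "decseq (\<lambda>k. f (s k))"
  proof (rule decseq_SucI)
    fix k
    have "f (s (Suc k)) + c * dist (s k) (s (Suc k)) \<le> f (s k)"
      using sS[of k "Suc k"] by (simp add: S_def)
    moreover have "0 \<le> c * dist (s k) (s (Suc k))" using c by simp
    ultimately show "f (s (Suc k)) \<le> f (s k)" by linarith
  qed
  then have "convergent (\<lambda>k. f (s k))"
    using nonneg decseq_convergent convergentI by metis
  then have Cf: "Cauchy (\<lambda>k. f (s k))" by (rule convergent_Cauchy)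
  have "Cauchy s"
  proof (rule metric_CauchyI)
    fix e :: real assume "0 < e"
    then obtain M where M: "\<And>m n. m \<ge> M \<Longrightarrow> n \<ge> M \<Longrightarrow> dist (f (s m)) (f (s n)) < c * e"
      using Cf c unfolding Cauchy_def by (metis mult_pos_pos)
    have *: "dist (s m) (s n) < e" if "M \<le> m" "m \<le> n" for m n
    proof -
      have "c * dist (s m) (s n) \<le> f (s m) - f (s n)" using sS[OF that(2)] by (simp add: S_def)
      also have "\<dots> < c * e" using M[of m n] that by (simp add: dist_real_def)
      finally show ?thesis using c by simp
    qed
    show "\<exists>M. \<forall>m\<ge>M. \<forall>n\<ge>M. dist (s m) (s n) < e"
      by (rule exI[of _ M]) (metis * dist_commute nle_le)
  qed
  then obtain z where z: "s \<longlonglongrightarrow> z" using Cauchy_convergent_iff convergent_def by blast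
  have fz: "(\<lambda>k. f (s k)) \<longlonglongrightarrow> f z"
    using z cont continuous_on_tendsto_compose by fastforce
  have zS: "z \<in> S (s k)" for k
  proof -
    have "(\<lambda>j. f (s j) + c * dist (s k) (s j)) \<longlonglongrightarrow> f z + c * dist (s k) z"
      by (intro tendsto_intros fz z)
    moreover have "\<forall>j\<ge>k. f (s j) + c * dist (s k) (s j) \<le> f (s k)"
      using sS by (auto simp: S_def)
    ultimately show ?thesis unfolding S_def using LIMSEQ_le_const2 by blast
  qed
  have "f z + c * dist x z \<le> f x" using zS[of 0] by (simp add: S_def s0)
  then have dz: "dist x z \<le> f x / c" using nonneg[of z] c by (simp add: field_simps)
  have "f z = 0"
  proof (rule ccontr)
    assume "f z \<noteq> 0"
    then have "0 < f z" using nonneg[of z] by simp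
    from step[OF dz this] obtain v where v: "v \<noteq> z" "v \<in> S z" by (auto simp: S_def)
    \<comment> \<open>\<open>v\<close> lies below \<open>z\<close>, hence below every
      \<open>s k\<close>, so it competed in each near-minimal choice. In the limit
      \<open>f z \<le> f v\<close>, against the strict decrease.\<close>
    have "f (s (Suc k)) \<le> f v + (1/2)^k" for k
      unfolding sSuc by (rule nxt(2)) (rule S_trans[OF zS v(2)])
    moreover have "(\<lambda>k. f v + (1/2)^k) \<longlonglongrightarrow> f v + 0"
      by (intro tendsto_intros LIMSEQ_power_zero) auto
    ultimately have "f z \<le> f v"
      using LIMSEQ_le[OF LIMSEQ_Suc[OF fz], of _ "f v"] by auto
    moreover have "0 < c * dist z v" using v(1) c by simp
    ultimately show False using v(2) by (simp add: S_def)
  qed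
  then show ?thesis using dz by blast
qed

text \<open>A short step along \<open>d\<close> lowers every piece attaining the maximum at a rate
  above \<open>c\<close>, while the other pieces stay below \<open>f u\<close> by continuity. The
  constant piece 0 is of the second kind because \<open>f u > 0\<close>. This gives the decrease
  needed although \<open>f\<close> itself is not smooth.\<close>

lemma max_family_error_bound:
  fixes g :: "'l \<Rightarrow> 'a::{real_inner,complete_space} \<Rightarrow> real"
  assumes fin: "finite L"
    and deriv: "\<And>l u. l \<in> L \<Longrightarrow> (g l has_derivative (\<lambda>v. G l u \<bullet> v)) (at u)"
    and f_def: "\<And>u. f u = Max (insert 0 ((\<lambda>l. g l u) ` L))"
    and c: "0 < c"
    and descent: "\<And>u. dist x u \<le> f x / c \<Longrightarrow> 0 < f u \<Longrightarrow>
      \<exists>d. d \<noteq> 0 \<and> norm d \<le> 1 \<and> (\<forall>l\<in>L. g l u = f u \<longrightarrow> G l u \<bullet> d < - c)"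
  shows "\<exists>z. (\<forall>l\<in>L. g l z \<le> 0) \<and> dist x z \<le> f x / c"
proof -
  have gcont: "continuous_on UNIV (g l)" if "l \<in> L" for l
    by (intro continuous_at_imp_continuous_on ballI has_derivative_continuous[OF deriv[OF that]])
  have g_le: "g l u \<le> f u" if "l \<in> L" for l u using that fin by (simp add: f_def)
  have f_le: "f u \<le> a \<longleftrightarrow> 0 \<le> a \<and> (\<forall>l\<in>L. g l u \<le> a)" for u a using fin by (simp add: f_def)
  have "continuous_on UNIV (\<lambda>u. Max (insert 0 ((\<lambda>l. g l u) ` L)))"
    using fin gcont
  proof (induction L rule: finite_induct)
    case (insert l L)
    have "Max (insert 0 ((\<lambda>l. g l u) ` insert l L)) = max (g l u) (Max (insert 0 ((\<lambda>l. g l u) ` L)))"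
      for u using insert.hyps(1) by (simp add: insert_commute[of 0] del: Max_insert) (rule Max_insert; simp)
    then show ?case using insert by (auto intro!: continuous_intros)
  qed simp
  then have fcont: "continuous_on UNIV f" by (simp add: f_def[abs_def])
  have nonneg: "0 \<le> f u" for u using fin by (simp add: f_def)
  have "\<exists>v. v \<noteq> u \<and> f v + c * dist u v \<le> f u" if u: "dist x u \<le> f x / c" "0 < f u" for u
  proof -
    obtain d where d: "d \<noteq> 0" "norm d \<le> 1" "\<And>l. l \<in> L \<Longrightarrow> g l u = f u \<Longrightarrow> G l u \<bullet> d < - c"
      using descent[OF u] by blast
    have lim0: "((\<lambda>t. a + t * c) \<longlongrightarrow> a) (at_right (0::real))" for a
      by (auto intro!: tendsto_eq_intros)
    have "\<forall>\<^sub>F t in at_right 0. g l (u + t *\<^sub>R d) + t * c < f u" if l: "l \<in> L" for l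
    proof (cases "g l u = f u")
      case True
      have "((\<lambda>t. u + t *\<^sub>R d) has_derivative (\<lambda>t. t *\<^sub>R d)) (at 0)"
        by (auto intro!: derivative_eq_intros)
      from has_derivative_compose[OF this, of "g l" "\<lambda>v. G l u \<bullet> v"] deriv[OF l, of u]
      have "((\<lambda>t. g l (u + t *\<^sub>R d)) has_derivative (\<lambda>t. G l u \<bullet> (t *\<^sub>R d))) (at 0)" by simp
      \<comment> \<open>The term \<open>t * c\<close> charges for the step in advance: as
        \<open>norm d \<le> 1\<close>, it dominates \<open>c\<close> times the distance
        moved.\<close>
      then have "((\<lambda>t. g l (u + t *\<^sub>R d) + t * c) has_real_derivative (G l u \<bullet> d + c)) (at 0)"
        unfolding has_field_derivative_def
        by (auto intro!: derivative_eq_intros simp: fun_eq_iff algebra_simps)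
      then have "\<exists>e>0. \<forall>t>0. t < e \<longrightarrow> g l (u + (0+t) *\<^sub>R d) + (0+t) * c < g l (u + 0 *\<^sub>R d) + 0 * c"
        using DERIV_neg_dec_right d(3)[OF l True]
        by (metis (no_types, lifting) add.commute add_less_cancel_left add.right_neutral neg_eq_iff_add_eq_0)
      then show ?thesis using True by (auto simp: eventually_at_right_field)
    next
      case False
      then have lt: "g l u < f u" using g_le[OF l, of u] by simp
      have "isCont (g l) (u + 0 *\<^sub>R d)" using gcont[OF l] continuous_on_eq_continuous_at by auto
      then have "((\<lambda>t. g l (u + t *\<^sub>R d)) \<longlongrightarrow> g l (u + 0 *\<^sub>R d)) (at_right 0)"
        by (rule isCont_tendsto_compose) (intro tendsto_intros)
      then have "((\<lambda>t. g l (u + t *\<^sub>R d) + t * c) \<longlongrightarrow> g l u + 0 * c) (at_right 0)"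
        by (intro tendsto_intros) simp
      then show ?thesis using lt by (simp add: order_tendstoD(2))
    qed
    then have "\<forall>\<^sub>F t in at_right 0. \<forall>l\<in>L. g l (u + t *\<^sub>R d) + t * c < f u"
      using fin by (simp add: eventually_ball_finite)
    moreover have "\<forall>\<^sub>F t in at_right 0. 0 + t * c < f u"
      using order_tendstoD(2)[OF lim0] u(2) by blast
    moreover have "\<forall>\<^sub>F t in at_right (0::real). 0 < t" by (simp add: eventually_at_right_less)
    ultimately have "\<forall>\<^sub>F t in at_right 0. 0 < t \<and> t * c < f u \<and> (\<forall>l\<in>L. g l (u + t *\<^sub>R d) + t * c < f u)"
      by eventually_elim auto
    then obtain t where t: "0 < t" "t * c < f u" "\<And>l. l \<in> L \<Longrightarrow> g l (u + t *\<^sub>R d) + t * c < f u"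
      using eventually_happens'[OF trivial_limit_at_right_real] by blast
    have "f (u + t *\<^sub>R d) \<le> f u - t * c"
      unfolding f_le using t by (auto simp: le_diff_eq intro: less_imp_le)
    moreover have "c * dist u (u + t *\<^sub>R d) \<le> t * c"
      using t(1) c d(2) by (simp add: dist_norm mult.commute mult_left_le)
    ultimately show ?thesis
      using d(1) t(1) by (intro exI[of _ "u + t *\<^sub>R d"]) auto
  qed
  from decrease_condition_imp_zero[OF fcont nonneg c this]
  obtain z where "f z = 0" "dist x z \<le> f x / c" by blast
  then show ?thesis using g_le[of _ z] by (intro exI[of _ z]) auto
qed

text \<open>The hull of finitely many points is compact in any dimension, so it has a point
  \<open>w\<close> of least norm, and \<open>- w\<close> is the direction sought.\<close>

lemma convex_hull_separate_0:
  fixes S :: "'a::real_inner set"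
  assumes fin: "finite S" and 0: "0 \<notin> convex hull S"
  shows "\<exists>d. \<forall>v\<in>S. v \<bullet> d < 0"
proof (cases "S = {}")
  case False
  have "\<exists>w\<in>convex hull S. \<forall>y\<in>convex hull S. norm w \<le> norm y"
    using finite_imp_compact_convex_hull[OF fin] False
    by (intro continuous_attains_inf) (auto intro!: continuous_intros)
  then obtain w where w: "w \<in> convex hull S" "\<And>y. y \<in> convex hull S \<Longrightarrow> norm w \<le> norm y" by blast
  have "v \<bullet> (- w) < 0" if v: "v \<in> S" for v
  proof (rule ccontr)
    assume "\<not> v \<bullet> (- w) < 0"
    then have "v \<bullet> w \<le> 0" by simp
    moreover have "0 < w \<bullet> w" using w(1) 0 by auto
    ultimately have neg: "w \<bullet> (v - w) < 0"
      by (simp only: inner_diff_right inner_commute[of w v])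
    \<comment> \<open>The slope of the squared norm from \<open>w\<close> towards \<open>v\<close>:
      if negative, some point of the hull on this segment is shorter than \<open>w\<close>.\<close>
    have "((\<lambda>t. (w + t *\<^sub>R (v - w)) \<bullet> (w + t *\<^sub>R (v - w))) has_real_derivative 2 * (w \<bullet> (v - w))) (at 0)"
      unfolding has_field_derivative_def
      by (auto intro!: derivative_eq_intros simp: fun_eq_iff inner_commute algebra_simps)
    from DERIV_neg_dec_right[OF this] neg
    obtain e where e: "0 < e"
      "\<And>t. 0 < t \<Longrightarrow> t < e \<Longrightarrow> (w + t *\<^sub>R (v - w)) \<bullet> (w + t *\<^sub>R (v - w)) < w \<bullet> w"
      by auto
    define t where "t = min (e/2) 1"
    have t: "0 < t" "t < e" "t \<le> 1" using e(1) by (auto simp: t_def)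
    have "w + t *\<^sub>R (v - w) = (1 - t) *\<^sub>R w + t *\<^sub>R v" by (simp add: algebra_simps)
    also have "\<dots> \<in> convex hull S"
      using t w(1) hull_inc[OF v] by (intro convexD[OF convex_convex_hull]) auto
    finally have "norm w \<le> norm (w + t *\<^sub>R (v - w))" by (rule w(2))
    then show False using e(2)[OF t(1,2)] by (simp add: norm_le)
  qed
  then show ?thesis by blast
qed simp

section \<open>Linear algebra of finite families\<close>

lemma span_image_imp_sum:
  fixes v :: "'b \<Rightarrow> 'a::real_vector"
  assumes "finite B" and "x \<in> span (v ` B)"
  shows "\<exists>\<beta>. x = (\<Sum>b\<in>B. \<beta> b *\<^sub>R v b)"
  using assms
proof (induction B arbitrary: x rule: finite_induct)
  case (insert b B)
  then obtain k where "x - k *\<^sub>R v b \<in> span (v ` B)" by (auto simp: span_insert)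
  then obtain \<beta> where \<beta>: "x - k *\<^sub>R v b = (\<Sum>a\<in>B. \<beta> a *\<^sub>R v a)" using insert.IH by blast
  have "(\<Sum>a\<in>insert b B. (\<beta>(b := k)) a *\<^sub>R v a) = k *\<^sub>R v b + (\<Sum>a\<in>B. (\<beta>(b := k)) a *\<^sub>R v a)"
    using insert.hyps by simp
  also have "(\<Sum>a\<in>B. (\<beta>(b := k)) a *\<^sub>R v a) = x - k *\<^sub>R v b"
    unfolding \<beta> using insert.hyps by (intro sum.cong) auto
  finally show ?case by (intro exI[of _ "\<beta>(b := k)"]) simp
qed simp

text \<open>Distinct constraints may have equal gradients, a repetition that the image set forgets.
  Injectivity together with independence of the image expresses linear independence of the indexed
  family.\<close>

lemma independent_family_iff:
  fixes v :: "'b \<Rightarrow> 'a::real_vector"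
  assumes fin: "finite B"
  shows "inj_on v B \<and> independent (v ` B) \<longleftrightarrow>
    (\<forall>\<beta>. (\<Sum>b\<in>B. \<beta> b *\<^sub>R v b) = 0 \<longrightarrow> (\<forall>b\<in>B. \<beta> b = 0))"
proof
  assume L: "inj_on v B \<and> independent (v ` B)"
  show "\<forall>\<beta>. (\<Sum>b\<in>B. \<beta> b *\<^sub>R v b) = 0 \<longrightarrow> (\<forall>b\<in>B. \<beta> b = 0)"
  proof (intro allI impI ballI)
    fix \<beta> b assume 0: "(\<Sum>b\<in>B. \<beta> b *\<^sub>R v b) = 0" and b: "b \<in> B"
    have "(\<Sum>x\<in>v ` B. \<beta> (the_inv_into B v x) *\<^sub>R x) = 0"
      using L 0 by (simp add: sum.reindex the_inv_into_f_f)
    then have "\<beta> (the_inv_into B v (v b)) = 0"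
      using L fin b
      by (intro independentD[of "v ` B" "v ` B" "\<lambda>x. \<beta> (the_inv_into B v x)"]) auto
    then show "\<beta> b = 0" using L b by (simp add: the_inv_into_f_f)
  qed
next
  assume R: "\<forall>\<beta>. (\<Sum>b\<in>B. \<beta> b *\<^sub>R v b) = 0 \<longrightarrow> (\<forall>b\<in>B. \<beta> b = 0)"
  have inj: "inj_on v B"
  proof (rule inj_onI, rule ccontr)
    fix a b assume ab: "a \<in> B" "b \<in> B" "v a = v b" "a \<noteq> b"
    \<comment> \<open>The indicator of \<open>a\<close> minus the indicator of \<open>b\<close> is a
      nontrivial relation as soon as \<open>v a = v b\<close>.\<close>
    let ?\<beta> = "\<lambda>c. (if c = a then 1 else 0) - (if c = b then 1 else (0::real))"
    have "(\<Sum>c\<in>B. ?\<beta> c *\<^sub>R v c) = 0"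
      using ab fin by (simp add: scaleR_left_diff_distrib sum_subtractf if_distrib[of "\<lambda>r. r *\<^sub>R _"] sum.delta cong: if_cong)
    then have "?\<beta> a = 0" using R[rule_format, of ?\<beta> a] ab(1) by simp
    then show False using ab(4) by simp
  qed
  have "independent (v ` B)"
  proof (rule independent_if_scalars_zero)
    fix f x assume "(\<Sum>x\<in>v ` B. f x *\<^sub>R x) = 0" "x \<in> v ` B"
    then show "f x = 0" using R[rule_format, of "f \<circ> v"] inj by (auto simp: sum.reindex)
  qed (use fin in simp)
  then show "inj_on v B \<and> independent (v ` B)" using inj by blast
qed

text \<open>Subtract from \<open>v b\<close> its projection onto the span of the other members. The
  remainder \<open>w\<close> is nonzero by independence, and dividing by
  \<open>v b \<bullet> w\<close> normalises it.\<close>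

lemma dual_family_exists:
  fixes v :: "'b \<Rightarrow> 'a::real_inner"
  assumes fin: "finite B" and inj: "inj_on v B" and ind: "independent (v ` B)"
  shows "\<exists>e. \<forall>a\<in>B. \<forall>b\<in>B. v a \<bullet> e b = (if a = b then 1 else 0)"
proof -
  have "\<exists>e. \<forall>a\<in>B. v a \<bullet> e = (if a = b then 1 else 0)" if b: "b \<in> B" for b
  proof -
    define S where "S = v ` (B - {b})"
    have S: "S = v ` B - {v b}" unfolding S_def using inj b by (auto simp: inj_on_def)
    have nin: "v b \<notin> span S" using ind b unfolding S dependent_def by blast
    obtain C where C: "finite C" "span C = span S" "pairwise orthogonal C"
      using basis_orthogonal[of S] fin by (auto simp: S_def)
    \<comment> \<open>A zero vector in \<open>C\<close> is harmless: its coefficient is a quotient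
      by 0, hence 0.\<close>
    define q where "q = (\<Sum>c\<in>C. (c \<bullet> v b / (c \<bullet> c)) *\<^sub>R c)"
    define w where "w = v b - q"
    have q: "q \<in> span C" unfolding q_def by (intro span_sum span_mul span_base)
    have "c \<bullet> w = 0" if c: "c \<in> C" for c
    proof -
      have "c \<bullet> q = (\<Sum>d\<in>C. if d = c then c \<bullet> v b else 0)"
        unfolding q_def inner_sum_right using C(3) c
        by (intro sum.cong) (auto simp: pairwise_def orthogonal_def inner_commute)
      then show ?thesis using C(1) c by (simp add: w_def inner_diff_right)
    qed
    then have "span C \<subseteq> {y. y \<bullet> w = 0}"
      by (intro span_minimal) (auto simp: subspace_def inner_left_distrib)
    then have orth: "y \<bullet> w = 0" if "y \<in> span S" for y using that C(2) by auto
    have "v b \<bullet> w = w \<bullet> w + q \<bullet> w" by (simp add: w_def inner_diff_left)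
    moreover have "q \<bullet> w = 0" using q orth C(2) by simp
    moreover have "w \<noteq> 0" using q nin C(2) by (auto simp: w_def)
    ultimately have nz: "v b \<bullet> w \<noteq> 0" by simp
    have "v a \<bullet> (w /\<^sub>R (v b \<bullet> w)) = (if a = b then 1 else 0)" if "a \<in> B" for a
      using nz orth[of "v a"] that by (auto simp: S_def intro: span_base)
    then show ?thesis by blast
  qed
  then show ?thesis by metis
qed

text \<open>The matrix of products \<open>u a \<bullet> e b\<close> is close to the identity, so
  \<open>c b\<close> differs from \<open>w \<bullet> e b\<close> by at most \<open>\<delta>\<close>
  times the sum of all \<open>\<bar>c b\<bar>\<close>. That sum is bounded in terms of itself, and
  \<open>\<delta> * card B \<le> 1/2\<close> lets it be absorbed. With \<open>w = 0\<close> this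
  gives stability of independence; with another gradient as \<open>w\<close>, closeness of its
  coefficients to the reference ones.\<close>

lemma near_dual_coefficients:
  fixes u :: "'b \<Rightarrow> 'a::real_inner" and a c :: "'b \<Rightarrow> real" and \<delta> \<eta> :: real
  assumes fin: "finite B" and \<delta>: "0 \<le> \<delta>" "\<delta> * card B \<le> 1/2"
    and near: "\<And>a b. a \<in> B \<Longrightarrow> b \<in> B \<Longrightarrow> \<bar>u a \<bullet> e b - (if a = b then 1 else 0)\<bar> \<le> \<delta>"
    and w: "w = (\<Sum>b\<in>B. c b *\<^sub>R u b)"
    and wa: "\<And>b. b \<in> B \<Longrightarrow> \<bar>w \<bullet> e b - a b\<bar> \<le> \<eta>"
    and b: "b \<in> B"
  shows "\<bar>c b - a b\<bar> \<le> \<eta> + 2 * \<delta> * ((\<Sum>b\<in>B. \<bar>a b\<bar>) + card B * \<eta>)"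
proof -
  define S where "S = (\<Sum>b\<in>B. \<bar>c b\<bar>)"
  have est: "\<bar>c b - a b\<bar> \<le> \<eta> + \<delta> * S" if b: "b \<in> B" for b
  proof -
    have "w \<bullet> e b - c b = (\<Sum>a\<in>B. c a * (u a \<bullet> e b)) - (\<Sum>a\<in>B. if a = b then c a else 0)"
      unfolding w using fin b by (simp add: inner_sum_left)
    also have "\<dots> = (\<Sum>a\<in>B. c a * (u a \<bullet> e b - (if a = b then 1 else 0)))"
      unfolding sum_subtractf[symmetric] by (intro sum.cong) (auto simp: algebra_simps)
    also have "\<bar>\<dots>\<bar> \<le> (\<Sum>a\<in>B. \<bar>c a * (u a \<bullet> e b - (if a = b then 1 else 0))\<bar>)" by (rule sum_abs)
    also have "\<dots> \<le> (\<Sum>a\<in>B. \<bar>c a\<bar> * \<delta>)"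
      unfolding abs_mult by (intro sum_mono mult_left_mono near b) auto
    finally have "\<bar>w \<bullet> e b - c b\<bar> \<le> \<delta> * S" by (simp add: S_def sum_distrib_left mult.commute)
    then show ?thesis using wa[OF b] by linarith
  qed
  have "S \<le> (\<Sum>b\<in>B. \<bar>a b\<bar> + (\<eta> + \<delta> * S))"
  proof (subst S_def, rule sum_mono)
    fix b assume "b \<in> B"
    from est[OF this] show "\<bar>c b\<bar> \<le> \<bar>a b\<bar> + (\<eta> + \<delta> * S)" by linarith
  qed
  also have "\<dots> = (\<Sum>b\<in>B. \<bar>a b\<bar>) + card B * \<eta> + (\<delta> * card B) * S"
    by (simp add: sum.distrib algebra_simps)
  also have "\<dots> \<le> (\<Sum>b\<in>B. \<bar>a b\<bar>) + card B * \<eta> + (1/2) * S"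
    using \<delta>(2) by (intro add_left_mono mult_right_mono) (auto simp: S_def sum_nonneg)
  finally have "S \<le> 2 * ((\<Sum>b\<in>B. \<bar>a b\<bar>) + card B * \<eta>)" by simp
  then have "\<delta> * S \<le> \<delta> * (2 * ((\<Sum>b\<in>B. \<bar>a b\<bar>) + card B * \<eta>))" using \<delta>(1) by (rule mult_left_mono)
  then show ?thesis using est[OF b] by (simp add: algebra_simps)
qed

text \<open>Otherwise \<open>u i\<close> and the members indexed by \<open>B\<close> would form an
  independent set larger than the dimension.\<close>

lemma full_rank_imp_span:
  fixes u :: "'b \<Rightarrow> 'a::real_vector"
  assumes fin: "finite J" and BJ: "B \<subseteq> J" and i: "i \<in> J"
    and inj: "inj_on u B" and ind: "independent (u ` B)" and rank: "dim (u ` J) = card B"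
  shows "u i \<in> span (u ` B)"
proof (rule ccontr)
  assume n: "u i \<notin> span (u ` B)"
  obtain T where T: "T \<subseteq> u ` J" "u ` J \<subseteq> span T" "card T = dim (u ` J)"
    using basis_exists[of "u ` J"] by metis
  have finT: "finite T" using T(1) fin by (meson finite_imageI finite_subset)
  have "independent (insert (u i) (u ` B))" using n ind by (rule independent_insertI)
  moreover have "insert (u i) (u ` B) \<subseteq> span T" using T(2) i BJ by auto
  ultimately have "card (insert (u i) (u ` B)) \<le> card T"
    using independent_span_bound[OF finT] by blast
  moreover have "finite B" using fin BJ by (rule rev_finite_subset)
  moreover have "u i \<notin> u ` B" using n span_base[of "u i" "u ` B"] by blast
  ultimately show False using T(3) rank inj by (simp add: card_image)
qed

section \<open>Functional dependence under constant rank\<close>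

text \<open>The map \<open>\<Psi>\<close> of the proof is a small Lipschitz perturbation of the identity whose \<open>v b\<close>-components
  are the functions \<open>f b\<close>; the path is the preimage under \<open>\<Psi>\<close> of a segment.\<close>
lemma straightened_path:
  fixes f :: "'b \<Rightarrow> 'a::{real_inner,complete_space} \<Rightarrow> real"
  assumes fin: "finite B" and r: "0 < r"
    and deriv: "\<And>b z. b \<in> B \<Longrightarrow> z \<in> cball x0 r \<Longrightarrow> (f b has_derivative (\<lambda>w. g b z \<bullet> w)) (at z)"
    and near: "\<And>b z. b \<in> B \<Longrightarrow> z \<in> cball x0 r \<Longrightarrow> norm (g b z - v b) \<le> \<delta>"
    and \<delta>: "\<delta> * (\<Sum>b\<in>B. norm (e b)) \<le> 1/2"
    and dual: "\<And>a b. a \<in> B \<Longrightarrow> b \<in> B \<Longrightarrow> v a \<bullet> e b = (if a = b then 1 else 0)"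
    and x: "x \<in> cball x0 (r/3)" and y: "y \<in> cball x0 (r/3)"
  shows "\<exists>\<gamma> L. \<gamma> 0 = y \<and> \<gamma> (1::real) = x \<and> \<gamma> ` {0..1} \<subseteq> cball x0 r \<and> L-lipschitz_on {0..1} \<gamma> \<and>
    (\<forall>t\<in>{0..1}. \<forall>b\<in>B. f b (\<gamma> t) = f b y + t * (f b x - f b y))"
proof -
  define \<phi> where "\<phi> z = (\<Sum>b\<in>B. (v b \<bullet> z - f b z) *\<^sub>R e b)" for z
  define \<Psi> where "\<Psi> z = z - \<phi> z" for z
  \<comment> \<open>\<open>v b \<bullet> z - f b z\<close> has gradient \<open>v b - g b z\<close>,
    of norm at most \<open>\<delta>\<close>. The mean value inequality and the bound on
    \<open>\<delta>\<close> make \<open>\<phi>\<close> a contraction on the ball.\<close>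
  have lip: "dist (\<phi> z) (\<phi> z') \<le> 1/2 * dist z z'" if z: "z \<in> cball x0 r" "z' \<in> cball x0 r" for z z'
  proof -
    have "norm ((v b \<bullet> z - f b z) - (v b \<bullet> z' - f b z')) \<le> \<delta> * norm (z - z')" if b: "b \<in> B" for b
    proof (rule differentiable_bound[OF convex_cball _ _ z(1) z(2)])
      fix u assume u: "u \<in> cball x0 r"
      show "((\<lambda>z. v b \<bullet> z - f b z) has_derivative (\<lambda>w. (v b - g b u) \<bullet> w)) (at u within cball x0 r)"
        unfolding inner_diff_left
        by (intro derivative_intros has_derivative_at_withinI[OF deriv[OF b u]])
      show "onorm (\<lambda>w. (v b - g b u) \<bullet> w) \<le> \<delta>"
        unfolding onorm_def
      proof (rule cSUP_least)
        fix w
        have "norm ((v b - g b u) \<bullet> w) \<le> norm (v b - g b u) * norm w" by (simp add: Cauchy_Schwarz_ineq2)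
        also have "\<dots> \<le> \<delta> * norm w"
          using near[OF b u] by (intro mult_right_mono) (auto simp: norm_minus_commute)
        finally show "norm ((v b - g b u) \<bullet> w) / norm w \<le> \<delta>"
          using order_trans[OF norm_ge_zero near[OF b u]] by (cases "w = 0") (auto simp: divide_le_eq)
      qed simp
    qed
    then have *: "norm (((v b \<bullet> z - f b z) - (v b \<bullet> z' - f b z')) *\<^sub>R e b) \<le> (\<delta> * norm (z - z')) * norm (e b)"
      if "b \<in> B" for b using that by (simp add: mult_right_mono)
    have "dist (\<phi> z) (\<phi> z') \<le> (\<Sum>b\<in>B. (\<delta> * norm (z - z')) * norm (e b))"
      unfolding \<phi>_def dist_norm sum_subtractf[symmetric] scaleR_left_diff_distrib[symmetric]
      by (intro sum_norm_le *)
    also have "\<dots> = (\<delta> * (\<Sum>b\<in>B. norm (e b))) * norm (z - z')"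
      by (simp add: sum_distrib_left sum_distrib_right mult_ac)
    also have "\<dots> \<le> 1/2 * dist z z'" unfolding dist_norm by (intro mult_right_mono \<delta>) simp
    finally show ?thesis .
  qed
  have f\<Psi>: "v b \<bullet> \<Psi> z = f b z" if b: "b \<in> B" for b z
  proof -
    have "v b \<bullet> \<phi> z = (\<Sum>a\<in>B. if a = b then v b \<bullet> z - f b z else 0)"
      unfolding \<phi>_def inner_sum_right using dual[OF b] by (intro sum.cong) auto
    then show ?thesis using fin b by (simp add: \<Psi>_def inner_diff_right)
  qed
  have x0: "x0 \<in> cball x0 r" using r by simp
  have xr: "x \<in> cball x0 r" and yr: "y \<in> cball x0 r" using x y r by auto
  \<comment> \<open>\<open>\<Psi>\<close> expands distances by at most 3/2, which takes radius
    \<open>r/3\<close> to \<open>r/2\<close>. The larger ball is convex, so it contains the segment,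
    and each of its points has a preimage within \<open>r\<close> of \<open>x0\<close>.\<close>
  have \<Psi>_near: "\<Psi> z \<in> cball (\<Psi> x0) (r/2)" if "z \<in> cball x0 (r/3)" for z
  proof -
    have z: "dist x0 z \<le> r/3" "z \<in> cball x0 r" using that r by auto
    have "norm ((x0 - z) - (\<phi> x0 - \<phi> z)) \<le> norm (x0 - z) + norm (\<phi> x0 - \<phi> z)" by (rule norm_triangle_ineq4)
    then have "dist (\<Psi> x0) (\<Psi> z) \<le> dist x0 z + dist (\<phi> x0) (\<phi> z)"
      by (simp add: \<Psi>_def dist_norm algebra_simps)
    then show ?thesis using lip[OF x0 z(2)] z(1) by simp
  qed
  have inj: "dist z z' \<le> 2 * dist (\<Psi> z) (\<Psi> z')" if "z \<in> cball x0 r" "z' \<in> cball x0 r" for z z'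
  proof -
    have "z - z' = (\<Psi> z - \<Psi> z') + (\<phi> z - \<phi> z')" by (simp add: \<Psi>_def)
    then have "dist z z' \<le> dist (\<Psi> z) (\<Psi> z') + dist (\<phi> z) (\<phi> z')"
      unfolding dist_norm by (metis norm_triangle_ineq)
    then show ?thesis using lip[OF that] by simp
  qed
  define p where "p t = (1 - t) *\<^sub>R \<Psi> y + t *\<^sub>R \<Psi> x" for t
  have surj: "\<exists>z. z \<in> cball x0 r \<and> \<Psi> z = p t" if t: "t \<in> {0..1}" for t
  proof -
    have p: "p t \<in> cball (\<Psi> x0) (r/2)" unfolding p_def
      using t by (intro convexD[OF convex_cball] \<Psi>_near x y) auto
    \<comment> \<open>\<open>\<Psi> z = p t\<close> is a fixed point equation. The map stays in the
      ball: \<open>r/2\<close> comes from \<open>p t\<close> and \<open>r/2\<close> from the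
      contraction.\<close>
    have "\<exists>!z\<in>cball x0 r. p t + \<phi> z = z"
    proof (rule Banach_fix[where c="1/2"])
      show "complete (cball x0 r)" by (simp add: complete_eq_closed)
      show "(\<lambda>z. p t + \<phi> z) ` cball x0 r \<subseteq> cball x0 r"
      proof clarify
        fix z assume z: "z \<in> cball x0 r"
        have "x0 - (p t + \<phi> z) = (\<Psi> x0 - p t) + (\<phi> x0 - \<phi> z)" by (simp add: \<Psi>_def)
        then have "dist x0 (p t + \<phi> z) \<le> dist (\<Psi> x0) (p t) + dist (\<phi> x0) (\<phi> z)"
          unfolding dist_norm by (metis norm_triangle_ineq)
        then show "p t + \<phi> z \<in> cball x0 r" using p z lip[OF x0 z] by simp
      qed
    qed (use r lip in auto)
    then obtain z where "z \<in> cball x0 r" "p t + \<phi> z = z" by blast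
    then show ?thesis by (intro exI[of _ z]) (auto simp: \<Psi>_def algebra_simps)
  qed
  then obtain \<gamma> where \<gamma>: "\<And>t. t \<in> {0..1} \<Longrightarrow> \<gamma> t \<in> cball x0 r" "\<And>t. t \<in> {0..1} \<Longrightarrow> \<Psi> (\<gamma> t) = p t"
    by metis
  have "\<gamma> 0 = y" using inj[OF \<gamma>(1) yr, of 0] \<gamma>(2)[of 0] by (simp add: p_def)
  moreover have "\<gamma> 1 = x" using inj[OF \<gamma>(1) xr, of 1] \<gamma>(2)[of 1] by (simp add: p_def)
  moreover have "(2 * norm (\<Psi> x - \<Psi> y))-lipschitz_on {0..1} \<gamma>"
  proof (rule lipschitz_onI)
    fix s t :: real assume st: "s \<in> {0..1}" "t \<in> {0..1}"
    have "p s - p t = (s - t) *\<^sub>R (\<Psi> x - \<Psi> y)" by (simp add: p_def algebra_simps)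
    then have "dist (p s) (p t) = dist s t * norm (\<Psi> x - \<Psi> y)" by (simp add: dist_norm)
    then show "dist (\<gamma> s) (\<gamma> t) \<le> 2 * norm (\<Psi> x - \<Psi> y) * dist s t"
      using inj[OF \<gamma>(1)[OF st(1)] \<gamma>(1)[OF st(2)]] st by (simp add: \<gamma>(2) mult_ac)
  qed simp
  moreover have "f b (\<gamma> t) = f b y + t * (f b x - f b y)" if "t \<in> {0..1}" "b \<in> B" for t b
  proof -
    have "f b (\<gamma> t) = v b \<bullet> p t" using f\<Psi> that \<gamma>(2) by metis
    also have "\<dots> = f b y + t * (f b x - f b y)"
      by (simp add: p_def inner_add_right f\<Psi>[OF that(2)] algebra_simps)
    finally show ?thesis .
  qed
  ultimately show ?thesis using \<gamma>(1) by blast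
qed

text \<open>The path is only Lipschitz, so the usual chain rule does not apply. At a critical point
  of \<open>G\<close> the increment of \<open>G\<close> is of higher order in the distance moved,
  and that distance is at most \<open>L\<close> times the time elapsed.\<close>

lemma critical_along_lipschitz_path:
  fixes \<gamma> :: "real \<Rightarrow> 'a::real_normed_vector" and G :: "'a \<Rightarrow> real"
  assumes G: "(G has_derivative (\<lambda>_. 0)) (at (\<gamma> t))" and lip: "L-lipschitz_on T \<gamma>" and t: "t \<in> T"
  shows "((\<lambda>s. G (\<gamma> s)) has_derivative (\<lambda>_. 0)) (at t within T)"
  unfolding has_derivative_within_alt
proof (intro conjI allI impI)
  fix \<epsilon> :: real assume \<epsilon>: "0 < \<epsilon>"
  have L: "0 \<le> L" using lip by (rule lipschitz_on_nonneg)
  \<comment> \<open>\<open>L + 1\<close> instead of \<open>L\<close> covers the case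
    \<open>L = 0\<close>.\<close>
  have "0 < \<epsilon> / (L + 1)" using \<epsilon> L by simp
  then obtain d where d: "0 < d"
      "\<And>z. norm (z - \<gamma> t) < d \<Longrightarrow> norm (G z - G (\<gamma> t)) \<le> \<epsilon> / (L + 1) * norm (z - \<gamma> t)"
    using G unfolding has_derivative_at_alt by auto
  have "norm (G (\<gamma> s) - G (\<gamma> t)) \<le> \<epsilon> * norm (s - t)" if s: "s \<in> T" "norm (s - t) < d / (L + 1)" for s
  proof -
    have le: "norm (\<gamma> s - \<gamma> t) \<le> L * norm (s - t)"
      using lipschitz_onD[OF lip s(1) t] by (simp add: dist_norm)
    also have le2: "\<dots> \<le> (L + 1) * norm (s - t)" by (intro mult_right_mono) auto
    also have "\<dots> < d" using s(2) L by (simp add: field_simps)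
    finally have "norm (G (\<gamma> s) - G (\<gamma> t)) \<le> \<epsilon> / (L + 1) * norm (\<gamma> s - \<gamma> t)" by (rule d(2))
    also have "\<dots> \<le> \<epsilon> / (L + 1) * ((L + 1) * norm (s - t))"
      using le le2 \<epsilon> L by (intro mult_left_mono) auto
    also have "\<dots> = \<epsilon> * norm (s - t)" using L by simp
    finally show ?thesis .
  qed
  moreover have "0 < d / (L + 1)" using d(1) L by simp
  ultimately show "\<exists>d>0. \<forall>s\<in>T. norm (s - t) < d \<longrightarrow>
      norm (G (\<gamma> s) - G (\<gamma> t) - 0) \<le> \<epsilon> * norm (s - t)" by auto
qed simp

lemma eventually_nhds_Pair_dist:
  fixes p0 :: "'p::metric_space" and x0 :: "'x::metric_space"
  assumes "eventually P (nhds (p0, x0))"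
  shows "\<exists>r>0. \<forall>p x. dist p p0 < r \<longrightarrow> dist x x0 < r \<longrightarrow> P (p, x)"
proof -
  obtain P1 P2 where "eventually P1 (nhds p0)" "eventually P2 (nhds x0)"
      and P: "\<And>p x. P1 p \<Longrightarrow> P2 x \<Longrightarrow> P (p, x)"
    using assms unfolding nhds_prod eventually_prod_filter by blast
  then obtain r1 r2 where "0 < r1" "\<And>p. dist p p0 < r1 \<Longrightarrow> P1 p" "0 < r2" "\<And>x. dist x x0 < r2 \<Longrightarrow> P2 x"
    unfolding eventually_nhds_metric by blast
  then show ?thesis using P by (intro exI[of _ "min r1 r2"]) auto
qed

text \<open>Join \<open>y\<close> to \<open>x\<close> by a path along which each
  \<open>h b p\<close> with \<open>b \<in> B\<close> is affine in time. Constant rank keeps the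
  gradient of \<open>h i0\<close> in the span of those of \<open>B\<close>, with coefficients near
  \<open>a\<close>, so the derivative of \<open>h i0\<close> along the path is such a combination of
  the increments. The mean value theorem selects one time whose coefficients serve; no continuity of
  the coefficients in time enters.\<close>

lemma constant_rank_dependence:
  fixes h :: "'i \<Rightarrow> 'p::metric_space \<Rightarrow> 'x::{real_inner,complete_space} \<Rightarrow> real"
  assumes fin: "finite J" and BJ: "B \<subseteq> J" and i0: "i0 \<in> J"
    and deriv: "\<And>i p x. i \<in> J \<Longrightarrow> (h i p has_derivative (\<lambda>w. gh i p x \<bullet> w)) (at x)"
    and cont: "\<And>i. i \<in> J \<Longrightarrow> isCont (\<lambda>(p, x). gh i p x) (p0, x0)"
    and inj: "inj_on (\<lambda>i. gh i p0 x0) B" and ind: "independent ((\<lambda>i. gh i p0 x0) ` B)"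
    and sp: "(\<lambda>i. gh i p0 x0) ` J \<subseteq> span ((\<lambda>i. gh i p0 x0) ` B)"
    and rank: "\<forall>\<^sub>F (p, x) in nhds (p0, x0). p \<in> D \<longrightarrow>
      dim ((\<lambda>i. gh i p x) ` J) = dim ((\<lambda>i. gh i p0 x0) ` J)"
    and a: "gh i0 p0 x0 = (\<Sum>b\<in>B. a b *\<^sub>R gh b p0 x0)"
    and \<epsilon>: "0 < \<epsilon>"
  shows "\<exists>r>0. \<forall>p x y. p \<in> D \<longrightarrow> dist p p0 < r \<longrightarrow> dist x x0 < r \<longrightarrow> dist y x0 < r \<longrightarrow>
    (\<exists>c. (\<forall>b\<in>B. \<bar>c b - a b\<bar> \<le> \<epsilon>) \<and> h i0 p x - h i0 p y = (\<Sum>b\<in>B. c b * (h b p x - h b p y)))"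
proof -
  define v where "v i = gh i p0 x0" for i
  have finB: "finite B" using fin BJ by (rule rev_finite_subset)
  obtain e where e: "\<And>a b. a \<in> B \<Longrightarrow> b \<in> B \<Longrightarrow> v a \<bullet> e b = (if a = b then 1 else 0)"
    using dual_family_exists[OF finB inj ind] unfolding v_def by blast
  have va: "v i0 \<bullet> e b = a b" if "b \<in> B" for b
  proof -
    have "v i0 \<bullet> e b = (\<Sum>c\<in>B. if c = b then a c else 0)"
      unfolding v_def a inner_sum_left using e that by (intro sum.cong) (auto simp: v_def)
    then show ?thesis using finB that by simp
  qed
  have dimB: "dim (v ` J) = card B"
    using basis_card_eq_dim[of "v ` B" "v ` J"] BJ sp inj ind
    by (auto simp: v_def card_image image_mono)
  define A where "A = (\<Sum>b\<in>B. \<bar>a b\<bar>)"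
  define E where "E = (\<Sum>b\<in>B. norm (e b))"
  have A: "0 \<le> A" and E: "0 \<le> E" by (auto simp: A_def E_def sum_nonneg)
  \<comment> \<open>The first bound gives both \<open>\<delta> * card B \<le> 1/2\<close> and
    \<open>\<delta> \<le> 1/2\<close>; the second brings the coefficient error
    \<open>\<delta> + 2 * \<delta> * (A + 1/2)\<close> below \<open>\<epsilon>\<close>.\<close>
  define \<delta> where "\<delta> = min (1 / (2 * (card B + 1))) (\<epsilon> / (2 + 2 * A))"
  have \<delta>0: "0 < \<delta>" using \<epsilon> A by (simp add: \<delta>_def)
  have "\<delta> * (card B + 1) \<le> 1 / (2 * (card B + 1)) * (card B + 1)"
    by (intro mult_right_mono) (auto simp: \<delta>_def)
  also have "\<dots> = 1/2" by (simp add: field_simps)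
  finally have \<delta>1: "\<delta> * (card B + 1) \<le> 1/2" by simp
  then have \<delta>card: "\<delta> * card B \<le> 1/2" and \<delta>half: "\<delta> \<le> 1/2"
    using \<delta>0 by (auto simp: algebra_simps intro: order_trans[rotated])
  have "\<delta> * (2 + 2 * A) \<le> \<epsilon> / (2 + 2 * A) * (2 + 2 * A)"
    using A by (intro mult_right_mono) (auto simp: \<delta>_def)
  then have \<delta>\<epsilon>: "\<delta> * (2 + 2 * A) \<le> \<epsilon>" using A by simp
  \<comment> \<open>The tolerance for the gradients themselves: Cauchy-Schwarz turns it into
    \<open>\<delta>\<close> for their products with \<open>e b\<close>. The added 1 covers
    \<open>E = 0\<close>.\<close>
  define \<tau> where "\<tau> = \<delta> / (E + 1)"
  have \<tau>0: "0 < \<tau>" using \<delta>0 E by (simp add: \<tau>_def)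
  have "\<tau> * (E + 1) = \<delta>" using E by (simp add: \<tau>_def)
  then have \<tau>E: "\<tau> * E \<le> \<delta>" using \<tau>0 by (simp add: algebra_simps)
  have "\<forall>\<^sub>F q in nhds (p0, x0). \<forall>i\<in>J. dist (gh i (fst q) (snd q)) (v i) < \<tau>"
  proof -
    have "\<forall>\<^sub>F q in nhds (p0, x0). dist (case q of (p, x) \<Rightarrow> gh i p x) (v i) < \<tau>" if "i \<in> J" for i
      using tendstoD[OF cont[OF that, unfolded isCont_def tendsto_at_iff_tendsto_nhds] \<tau>0] by (simp add: v_def)
    then show ?thesis using fin by (auto simp: case_prod_beta intro: eventually_ball_finite)
  qed
  with rank have "\<forall>\<^sub>F q in nhds (p0, x0). (\<forall>i\<in>J. dist (gh i (fst q) (snd q)) (v i) < \<tau>) \<and>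
      (fst q \<in> D \<longrightarrow> dim ((\<lambda>i. gh i (fst q) (snd q)) ` J) = card B)"
    by eventually_elim (auto simp: dimB[unfolded v_def] split: prod.splits)
  from eventually_nhds_Pair_dist[OF this] obtain R where R: "0 < R"
    and near: "\<And>p x i. dist p p0 < R \<Longrightarrow> dist x x0 < R \<Longrightarrow> i \<in> J \<Longrightarrow> dist (gh i p x) (v i) < \<tau>"
    and rk: "\<And>p x. dist p p0 < R \<Longrightarrow> dist x x0 < R \<Longrightarrow> p \<in> D \<Longrightarrow> dim ((\<lambda>i. gh i p x) ` J) = card B"
    by fastforce
  have coeff: "\<exists>c. gh i0 p x = (\<Sum>b\<in>B. c b *\<^sub>R gh b p x) \<and> (\<forall>b\<in>B. \<bar>c b - a b\<bar> \<le> \<epsilon>)"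
    if px: "p \<in> D" "dist p p0 < R" "dist x x0 < R" for p x
  proof -
    have ne: "\<bar>gh i p x \<bullet> e b - v i \<bullet> e b\<bar> \<le> \<delta>" if "i \<in> J" "b \<in> B" for i b
    proof -
      have "\<bar>gh i p x \<bullet> e b - v i \<bullet> e b\<bar> \<le> norm (gh i p x - v i) * norm (e b)"
        using Cauchy_Schwarz_ineq2[of "gh i p x - v i" "e b"] by (simp add: inner_diff_left)
      also have "\<dots> \<le> \<tau> * E"
        using near[OF px(2,3) that(1)] that(2) finB \<tau>0 unfolding E_def dist_norm
        by (intro mult_mono member_le_sum) auto
      finally show ?thesis using \<tau>E by simp
    qed
    have ne': "\<bar>gh i p x \<bullet> e b - (if i = b then 1 else 0)\<bar> \<le> \<delta>" if "i \<in> B" "b \<in> B" for i b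
      using ne[of i b] e that BJ by auto
    \<comment> \<open>With reference coefficients and error 0 the estimate says that the gradients
      indexed by \<open>B\<close> stay independent at \<open>(p, x)\<close>; constant rank then
      makes them span the others.\<close>
    have "\<beta> b = 0" if 0: "(\<Sum>b\<in>B. \<beta> b *\<^sub>R gh b p x) = 0" and b: "b \<in> B" for \<beta> b
      using near_dual_coefficients[OF finB less_imp_le[OF \<delta>0] \<delta>card ne' refl, of \<beta> "\<lambda>_. 0" 0 b] 0 b
      by simp
    then have "inj_on (\<lambda>i. gh i p x) B \<and> independent ((\<lambda>i. gh i p x) ` B)"
      using independent_family_iff[OF finB, of "\<lambda>i. gh i p x"] by blast
    then have "gh i0 p x \<in> span ((\<lambda>i. gh i p x) ` B)"
      using full_rank_imp_span[OF fin BJ i0, of "\<lambda>i. gh i p x"] rk[OF px(2,3,1)] by blast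
    then obtain c where c: "gh i0 p x = (\<Sum>b\<in>B. c b *\<^sub>R gh b p x)"
      using span_image_imp_sum[OF finB] by blast
    have "\<bar>c b - a b\<bar> \<le> \<epsilon>" if b: "b \<in> B" for b
    proof -
      have "\<bar>c b - a b\<bar> \<le> \<delta> + 2 * \<delta> * (A + card B * \<delta>)"
        unfolding A_def
        by (rule near_dual_coefficients[OF finB less_imp_le[OF \<delta>0] \<delta>card ne' c _ b])
          (use ne[OF i0] va in auto)
      also have "\<dots> \<le> \<delta> + 2 * \<delta> * (A + 1/2)"
        using \<delta>card \<delta>0 by (intro add_left_mono mult_left_mono) (auto simp: mult.commute)
      also have "\<dots> = \<delta> * (2 + 2 * A)" by (simp add: algebra_simps)
      finally show ?thesis using \<delta>\<epsilon> by simp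
    qed
    then show ?thesis using c by blast
  qed
  have "\<exists>c. (\<forall>b\<in>B. \<bar>c b - a b\<bar> \<le> \<epsilon>) \<and> h i0 p x - h i0 p y = (\<Sum>b\<in>B. c b * (h b p x - h b p y))"
    if p: "p \<in> D" "dist p p0 < R" and xy: "dist x x0 < R/6" "dist y x0 < R/6" for p x y
  proof -
    have inR: "dist z x0 < R" if "z \<in> cball x0 (R/2)" for z
      using that R by (auto simp: dist_commute)
    have xc: "x \<in> cball x0 (R/2/3)" and yc: "y \<in> cball x0 (R/2/3)"
      using xy by (auto simp: dist_commute)
    have d: "(h b p has_derivative (\<lambda>w. gh b p z \<bullet> w)) (at z)" if "b \<in> B" for b z
      using that BJ deriv by blast
    have nr: "norm (gh b p z - v b) \<le> \<tau>" if "b \<in> B" "z \<in> cball x0 (R/2)" for b z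
      using near[OF p(2) inR[OF that(2)], of b] that(1) BJ by (auto simp: dist_norm)
    have half: "\<tau> * (\<Sum>b\<in>B. norm (e b)) \<le> 1/2" using \<tau>E \<delta>half by (simp add: E_def)
    have "\<exists>\<gamma> L. \<gamma> 0 = y \<and> \<gamma> (1::real) = x \<and> \<gamma> ` {0..1} \<subseteq> cball x0 (R/2) \<and> L-lipschitz_on {0..1} \<gamma> \<and>
        (\<forall>t\<in>{0..1}. \<forall>b\<in>B. h b p (\<gamma> t) = h b p y + t * (h b p x - h b p y))"
      using R by (intro straightened_path[of B "R/2" x0 "\<lambda>b. h b p" "\<lambda>b. gh b p" v \<tau> e x y, OF finB _ d nr half e xc yc]) simp
    then obtain \<gamma> L where \<gamma>: "\<gamma> 0 = y" "\<gamma> (1::real) = x" "\<gamma> ` {0..1} \<subseteq> cball x0 (R/2)"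
      and lip: "L-lipschitz_on {0..1} \<gamma>"
      and aff: "\<And>t b. t \<in> {0..1} \<Longrightarrow> b \<in> B \<Longrightarrow> h b p (\<gamma> t) = h b p y + t * (h b p x - h b p y)"
      by (elim exE conjE) metis
    have "\<exists>c. gh i0 p (\<gamma> t) = (\<Sum>b\<in>B. c b *\<^sub>R gh b p (\<gamma> t)) \<and> (\<forall>b\<in>B. \<bar>c b - a b\<bar> \<le> \<epsilon>)"
      if "t \<in> {0..1}" for t
      using coeff[OF p inR] \<gamma>(3) that by blast
    then obtain c where c: "\<And>t. t \<in> {0..1} \<Longrightarrow> gh i0 p (\<gamma> t) = (\<Sum>b\<in>B. c t b *\<^sub>R gh b p (\<gamma> t))"
      "\<And>t b. t \<in> {0..1} \<Longrightarrow> b \<in> B \<Longrightarrow> \<bar>c t b - a b\<bar> \<le> \<epsilon>"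
      by metis
    define \<Delta> where "\<Delta> b = h b p x - h b p y" for b
    have der: "((\<lambda>s. h i0 p (\<gamma> s)) has_derivative (\<lambda>s. (\<Sum>b\<in>B. c t b * \<Delta> b) * s)) (at t within {0..1})"
      if t: "t \<in> {0..1}" for t
    proof -
      have "((\<lambda>z. h i0 p z - (\<Sum>b\<in>B. c t b * h b p z)) has_derivative
          (\<lambda>w. gh i0 p (\<gamma> t) \<bullet> w - (\<Sum>b\<in>B. c t b * (gh b p (\<gamma> t) \<bullet> w)))) (at (\<gamma> t))"
        by (intro derivative_intros deriv i0 d)
      moreover have "(\<lambda>w. gh i0 p (\<gamma> t) \<bullet> w - (\<Sum>b\<in>B. c t b * (gh b p (\<gamma> t) \<bullet> w))) = (\<lambda>_. 0)"
        by (simp add: c(1)[OF t] inner_sum_left)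
      ultimately have "((\<lambda>z. h i0 p z - (\<Sum>b\<in>B. c t b * h b p z)) has_derivative (\<lambda>_. 0)) (at (\<gamma> t))"
        by simp
      from critical_along_lipschitz_path[OF this lip t]
      have 1: "((\<lambda>s. h i0 p (\<gamma> s) - (\<Sum>b\<in>B. c t b * h b p (\<gamma> s))) has_derivative (\<lambda>_. 0)) (at t within {0..1})" .
      have "((\<lambda>s. \<Sum>b\<in>B. c t b * (h b p y + s * \<Delta> b)) has_derivative
          (\<lambda>s. \<Sum>b\<in>B. c t b * (s * \<Delta> b))) (at t within {0..1})"
        by (auto intro!: derivative_eq_intros)
      then have 2: "((\<lambda>s. \<Sum>b\<in>B. c t b * h b p (\<gamma> s)) has_derivative
          (\<lambda>s. \<Sum>b\<in>B. c t b * (s * \<Delta> b))) (at t within {0..1})"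
        by (rule has_derivative_transform[OF t, rotated]) (auto simp: aff \<Delta>_def)
      from has_derivative_add[OF 1 2] show ?thesis
        by (simp add: sum_distrib_left mult_ac)
    qed
    have "\<exists>t\<in>{0..1}. h i0 p (\<gamma> 1) - h i0 p (\<gamma> 0) = (\<Sum>b\<in>B. c t b * \<Delta> b) * (1 - 0)"
      by (rule mvt_very_simple) (use der in auto)
    then obtain t where t: "t \<in> {0..1}" "h i0 p x - h i0 p y = (\<Sum>b\<in>B. c t b * \<Delta> b)"
      using \<gamma>(1,2) by auto
    then show ?thesis using c(2) unfolding \<Delta>_def by (intro exI[of _ "c t"]) blast
  qed
  then show ?thesis using R by (intro exI[of _ "R/6"]) auto
qed

section \<open>Positive circuits of gradients\<close>

text \<open>Gordan's alternative for an indexed family. The convex weights belong to vectors; each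
  vector hands its weight to one index in \<open>\<Lambda>'\<close>, so coinciding vectors are not
  counted twice.\<close>

lemma family_separation:
  fixes G :: "'l \<Rightarrow> 'a::real_inner"
  assumes fin: "finite \<Lambda>" and no: "\<not> (\<exists>d. \<forall>l\<in>\<Lambda>. G l \<bullet> d < 0)"
  shows "\<exists>\<mu>. (\<forall>l\<in>\<Lambda>. 0 \<le> \<mu> l) \<and> sum \<mu> \<Lambda> = (1::real) \<and> (\<Sum>l\<in>\<Lambda>. \<mu> l *\<^sub>R G l) = 0"
proof -
  have "0 \<in> convex hull (G ` \<Lambda>)" using convex_hull_separate_0[of "G ` \<Lambda>"] fin no by auto
  then obtain w where w: "\<And>y. y \<in> G ` \<Lambda> \<Longrightarrow> 0 \<le> w y" "sum w (G ` \<Lambda>) = 1" "(\<Sum>y\<in>G ` \<Lambda>. w y *\<^sub>R y) = 0"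
    using fin by (subst (asm) convex_hull_finite) auto
  obtain \<Lambda>' where \<Lambda>': "\<Lambda>' \<subseteq> \<Lambda>" "inj_on G \<Lambda>'" "G ` \<Lambda> = G ` \<Lambda>'"
    using subset_image_inj[of "G ` \<Lambda>" G \<Lambda>] by auto
  define \<mu> where "\<mu> l = (if l \<in> \<Lambda>' then w (G l) else 0)" for l
  have "sum \<mu> \<Lambda> = sum \<mu> \<Lambda>'" "(\<Sum>l\<in>\<Lambda>. \<mu> l *\<^sub>R G l) = (\<Sum>l\<in>\<Lambda>'. \<mu> l *\<^sub>R G l)"
    by (rule sum.mono_neutral_right; use fin \<Lambda>'(1) in \<open>auto simp: \<mu>_def\<close>)+
  moreover have "sum \<mu> \<Lambda>' = 1" "(\<Sum>l\<in>\<Lambda>'. \<mu> l *\<^sub>R G l) = 0"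
    using w(2,3) \<Lambda>'(2) by (simp_all add: \<Lambda>'(3) sum.reindex \<mu>_def)
  ultimately show ?thesis using w(1) by (intro exI[of _ \<mu>]) (auto simp: \<mu>_def)
qed

text \<open>Caratheodory's reduction modulo the span of the \<open>J\<close> members: take a
  positive combination of least support and set one index aside. A relation among the rest and
  \<open>J\<close> could be subtracted until a coefficient vanishes, giving a smaller
  support.\<close>

lemma positive_circuit_exists:
  fixes v :: "'i \<Rightarrow> 'a::real_vector"
  assumes finA: "finite A" and finJ: "finite J" and disj: "A \<inter> J = {}"
    and J: "inj_on v J" "independent (v ` J)"
    and nonneg: "\<And>i. i \<in> A \<Longrightarrow> (0::real) \<le> \<nu> i" and pos: "i \<in> A" "0 < \<nu> i"
    and sp: "(\<Sum>i\<in>A. \<nu> i *\<^sub>R v i) \<in> span (v ` J)"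
  shows "\<exists>C i0 \<nu>. C \<subseteq> A \<and> i0 \<in> C \<and> (\<forall>i\<in>C. (0::real) < \<nu> i) \<and> (\<Sum>i\<in>C. \<nu> i *\<^sub>R v i) \<in> span (v ` J) \<and>
    inj_on v (J \<union> (C - {i0})) \<and> independent (v ` (J \<union> (C - {i0})))"
proof -
  define P where "P C \<longleftrightarrow> C \<subseteq> A \<and> C \<noteq> {} \<and>
    (\<exists>\<nu>. (\<forall>i\<in>C. (0::real) < \<nu> i) \<and> (\<Sum>i\<in>C. \<nu> i *\<^sub>R v i) \<in> span (v ` J))" for C
  have P_support: "P {i\<in>C. 0 < \<kappa> i}"
    if C: "C \<subseteq> A" and \<kappa>: "\<And>i. i \<in> C \<Longrightarrow> (0::real) \<le> \<kappa> i" "i \<in> C" "0 < \<kappa> i"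
      "(\<Sum>i\<in>C. \<kappa> i *\<^sub>R v i) \<in> span (v ` J)" for C \<kappa> i
  proof -
    have "(\<Sum>i\<in>{i\<in>C. 0 < \<kappa> i}. \<kappa> i *\<^sub>R v i) = (\<Sum>i\<in>C. \<kappa> i *\<^sub>R v i)"
      using \<kappa>(1) finite_subset[OF C finA] by (intro sum.mono_neutral_left) force+
    then show ?thesis unfolding P_def using C \<kappa> by (intro conjI exI[of _ \<kappa>]) auto
  qed
  have "P {i\<in>A. 0 < \<nu> i}" by (rule P_support) (use assms in auto)
  then obtain C where C: "P C" and min: "\<And>C'. P C' \<Longrightarrow> card C \<le> card C'"
    using ex_has_least_nat[of P _ card] by blast
  from C obtain \<kappa> i0 where CA: "C \<subseteq> A" and i0: "i0 \<in> C" and \<kappa>: "\<And>i. i \<in> C \<Longrightarrow> (0::real) < \<kappa> i"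
      "(\<Sum>i\<in>C. \<kappa> i *\<^sub>R v i) \<in> span (v ` J)"
    unfolding P_def by blast
  have finC: "finite C" using CA finA by (rule finite_subset)
  have "\<beta> b = 0" if 0: "(\<Sum>b\<in>J \<union> (C - {i0}). \<beta> b *\<^sub>R v b) = 0" and b: "b \<in> J \<union> (C - {i0})" for \<beta> b
  proof -
    have split: "(\<Sum>b\<in>J. \<beta> b *\<^sub>R v b) + (\<Sum>b\<in>C - {i0}. \<beta> b *\<^sub>R v b) = 0"
      using 0 by (subst (asm) sum.union_disjoint) (use finJ finC CA disj in auto)
    have zero: "\<beta> b = 0" if b1: "b \<in> C - {i0}" for b
    proof (rule ccontr)
      assume nz: "\<beta> b \<noteq> 0"
      \<comment> \<open>The entry at \<open>i0\<close> is 0, so \<open>\<kappa> i0\<close> survives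
        the subtraction and the support stays nonempty. The sign makes the entry at \<open>b\<close>
        positive, so the ratio test has a candidate.\<close>
      define \<beta>' where "\<beta>' i = (if i = i0 then 0 else sgn (\<beta> b) * \<beta> i)" for i
      have "(\<Sum>i\<in>C. \<beta>' i *\<^sub>R v i) = (\<Sum>i\<in>C - {i0}. sgn (\<beta> b) *\<^sub>R (\<beta> i *\<^sub>R v i))"
        unfolding \<beta>'_def using finC i0 by (subst sum.remove[of _ i0]) (auto intro!: sum.cong)
      also have "\<dots> = - sgn (\<beta> b) *\<^sub>R (\<Sum>b\<in>J. \<beta> b *\<^sub>R v b)"
        using split unfolding scaleR_sum_right[symmetric] by (simp add: add_eq_0_iff)
      also have "\<dots> \<in> span (v ` J)" by (intro span_mul span_sum span_base) auto
      finally have \<beta>'_span: "(\<Sum>i\<in>C. \<beta>' i *\<^sub>R v i) \<in> span (v ` J)" .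
      define T where "T = {i\<in>C. 0 < \<beta>' i}"
      have T: "finite T" "b \<in> T" using finC b1 nz by (auto simp: T_def \<beta>'_def sgn_if)
      \<comment> \<open>The largest multiple that keeps all coefficients nonnegative; it annihilates
        the one at \<open>i1\<close>.\<close>
      define \<theta> where "\<theta> = Min ((\<lambda>i. \<kappa> i / \<beta>' i) ` T)"
      have "\<theta> \<in> (\<lambda>i. \<kappa> i / \<beta>' i) ` T" unfolding \<theta>_def using T by (intro Min_in) auto
      then obtain i1 where i1: "i1 \<in> T" "\<theta> = \<kappa> i1 / \<beta>' i1" by auto
      have \<theta>0: "0 \<le> \<theta>" using i1 \<kappa>(1) by (auto simp: T_def intro!: divide_nonneg_pos less_imp_le)
      have ge: "0 \<le> \<kappa> i - \<theta> * \<beta>' i" if i: "i \<in> C" for i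
      proof (cases "i \<in> T")
        case True
        then have "\<theta> \<le> \<kappa> i / \<beta>' i" unfolding \<theta>_def using T by (intro Min_le) auto
        then show ?thesis using True by (simp add: T_def field_simps)
      next
        case False
        then have "\<theta> * \<beta>' i \<le> 0" using i \<theta>0 by (simp add: T_def mult_nonneg_nonpos)
        then show ?thesis using \<kappa>(1)[OF i] by simp
      qed
      have "(\<Sum>i\<in>C. (\<kappa> i - \<theta> * \<beta>' i) *\<^sub>R v i) = (\<Sum>i\<in>C. \<kappa> i *\<^sub>R v i) - \<theta> *\<^sub>R (\<Sum>i\<in>C. \<beta>' i *\<^sub>R v i)"
        by (simp add: scaleR_left_diff_distrib sum_subtractf scaleR_sum_right)
      also have "\<dots> \<in> span (v ` J)" by (intro span_diff span_mul \<kappa>(2) \<beta>'_span)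
      finally have "P {i\<in>C. 0 < \<kappa> i - \<theta> * \<beta>' i}"
        using P_support[OF CA ge i0] \<kappa>(1)[OF i0] by (simp add: \<beta>'_def)
      then have "card C \<le> card {i\<in>C. 0 < \<kappa> i - \<theta> * \<beta>' i}" by (rule min)
      moreover have "i1 \<in> C" "\<kappa> i1 - \<theta> * \<beta>' i1 = 0" using i1 by (auto simp: T_def)
      then have "{i\<in>C. 0 < \<kappa> i - \<theta> * \<beta>' i} \<subset> C" by force
      then have "card {i\<in>C. 0 < \<kappa> i - \<theta> * \<beta>' i} < card C" by (rule psubset_card_mono[OF finC])
      ultimately show False by simp
    qed
    then have "(\<Sum>b\<in>J. \<beta> b *\<^sub>R v b) = 0" using split by simp
    then have "\<forall>b\<in>J. \<beta> b = 0" using independent_family_iff[OF finJ, of v] J by blast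
    then show ?thesis using zero b by blast
  qed
  then have "inj_on v (J \<union> (C - {i0})) \<and> independent (v ` (J \<union> (C - {i0})))"
    using independent_family_iff[of "J \<union> (C - {i0})" v] finJ finC by blast
  then show ?thesis using CA i0 \<kappa> by blast
qed

text \<open>The radius \<open>r\<close> doubles as the factor in \<open>r * t\<close>, so that the conclusion is monotone in a single
  parameter and finitely many such statements can be merged.\<close>
lemma circuit_infeasible:
  fixes h :: "'i \<Rightarrow> 'p::metric_space \<Rightarrow> 'x::{real_inner,complete_space} \<Rightarrow> real"
  assumes finI0: "finite I0" and JI0: "J \<subseteq> I0" and finC: "finite C" and disj: "C \<inter> I0 = {}" and i0: "i0 \<in> C"
    and deriv: "\<And>i p x. i \<in> I0 \<union> C \<Longrightarrow> (h i p has_derivative (\<lambda>w. gh i p x \<bullet> w)) (at x)"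
    and cont: "\<And>i. i \<in> I0 \<union> C \<Longrightarrow> isCont (\<lambda>(p, x). gh i p x) (p0, x0)"
    and inj: "inj_on (\<lambda>i. gh i p0 x0) (J \<union> (C - {i0}))"
    and ind: "independent ((\<lambda>i. gh i p0 x0) ` (J \<union> (C - {i0})))"
    and sp: "(\<lambda>i. gh i p0 x0) ` I0 \<subseteq> span ((\<lambda>i. gh i p0 x0) ` J)"
    and rank: "\<forall>\<^sub>F (p, x) in nhds (p0, x0). p \<in> D \<longrightarrow>
      dim ((\<lambda>i. gh i p x) ` (I0 \<union> C)) = dim ((\<lambda>i. gh i p0 x0) ` (I0 \<union> C))"
    and pos: "\<And>i. i \<in> C \<Longrightarrow> 0 < \<nu> i"
    and dep: "(\<Sum>i\<in>C. \<nu> i *\<^sub>R gh i p0 x0) \<in> span ((\<lambda>i. gh i p0 x0) ` J)"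
  shows "\<exists>r>0. \<forall>p x y t. p \<in> D \<longrightarrow> dist p p0 < r \<longrightarrow> dist x x0 < r \<longrightarrow> dist y x0 < r \<longrightarrow>
    (\<forall>i\<in>C. h i p y \<le> 0) \<longrightarrow> (\<forall>j\<in>I0. h j p y = 0) \<longrightarrow> 0 < t \<longrightarrow> (\<forall>i\<in>C. t \<le> h i p x) \<longrightarrow>
    (\<exists>j\<in>J. r * t < \<bar>h j p x\<bar>)"
proof -
  define v where "v i = gh i p0 x0" for i
  define B where "B = J \<union> (C - {i0})"
  have finJ: "finite J" using JI0 finI0 by (rule finite_subset)
  have dJ: "J \<inter> (C - {i0}) = {}" using disj JI0 by blast
  obtain \<mu> where \<mu>: "(\<Sum>i\<in>C. \<nu> i *\<^sub>R v i) = (\<Sum>j\<in>J. \<mu> j *\<^sub>R v j)"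
    using span_image_imp_sum[OF finJ dep] unfolding v_def by blast
  \<comment> \<open>The circuit relation solved for \<open>v i0\<close>: the coefficients on the
    rest of the circuit are negative, those on \<open>J\<close> have no prescribed sign.\<close>
  define a where "a b = (if b \<in> J then \<mu> b / \<nu> i0 else - \<nu> b / \<nu> i0)" for b
  have l0: "0 < \<nu> i0" using pos i0 .
  have "\<nu> i0 *\<^sub>R v i0 = (\<Sum>j\<in>J. \<mu> j *\<^sub>R v j) - (\<Sum>i\<in>C - {i0}. \<nu> i *\<^sub>R v i)"
    using \<mu> by (subst (asm) sum.remove[OF finC i0]) (simp add: algebra_simps)
  moreover have "\<nu> i0 *\<^sub>R (\<Sum>b\<in>B. a b *\<^sub>R v b) = (\<Sum>j\<in>J. (\<nu> i0 * a j) *\<^sub>R v j) + (\<Sum>i\<in>C - {i0}. (\<nu> i0 * a i) *\<^sub>R v i)"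
    unfolding B_def using dJ finJ finC by (subst sum.union_disjoint) (auto simp: scaleR_sum_right scaleR_right_distrib)
  moreover have "(\<Sum>j\<in>J. (\<nu> i0 * a j) *\<^sub>R v j) = (\<Sum>j\<in>J. \<mu> j *\<^sub>R v j)"
    using l0 by (intro sum.cong) (auto simp: a_def)
  moreover have "(\<Sum>i\<in>C - {i0}. (\<nu> i0 * a i) *\<^sub>R v i) = - (\<Sum>i\<in>C - {i0}. \<nu> i *\<^sub>R v i)"
    unfolding sum_negf[symmetric] using l0 dJ by (intro sum.cong) (auto simp: a_def)
  ultimately have "\<nu> i0 *\<^sub>R v i0 = \<nu> i0 *\<^sub>R (\<Sum>b\<in>B. a b *\<^sub>R v b)" by simp
  then have va: "v i0 = (\<Sum>b\<in>B. a b *\<^sub>R v b)" using l0 by simp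
  have spB: "v ` (I0 \<union> C) \<subseteq> span (v ` B)"
  proof -
    have "span (v ` J) \<subseteq> span (v ` B)" by (intro span_mono) (auto simp: B_def)
    then have "v ` I0 \<subseteq> span (v ` B)" using sp by (auto simp: v_def)
    moreover have "v i0 \<in> span (v ` B)" unfolding va by (intro span_sum span_mul span_base) auto
    moreover have "v ` (C - {i0}) \<subseteq> span (v ` B)" by (auto simp: B_def intro: span_base)
    ultimately show ?thesis by blast
  qed
  \<comment> \<open>Coefficients within \<open>\<epsilon>\<close> of \<open>a\<close> stay
    nonpositive on \<open>C - {i0}\<close> and at most \<open>\<bar>a b\<bar> + 1\<close> in
    absolute value on \<open>J\<close>.\<close>
  define \<epsilon> where "\<epsilon> = Min (insert 1 ((\<lambda>b. - a b) ` (C - {i0})))"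
  have neg: "a b < 0" if "b \<in> C - {i0}" for b
    using that dJ pos l0 by (auto simp: a_def divide_neg_pos)
  have \<epsilon>0: "0 < \<epsilon>" and \<epsilon>1: "\<epsilon> \<le> 1" and \<epsilon>a: "\<And>b. b \<in> C - {i0} \<Longrightarrow> \<epsilon> \<le> - a b"
    using finC neg by (auto simp: \<epsilon>_def)
  obtain R where R: "0 < R" and dp: "\<And>p x y. p \<in> D \<Longrightarrow> dist p p0 < R \<Longrightarrow> dist x x0 < R \<Longrightarrow> dist y x0 < R \<Longrightarrow>
    (\<exists>c. (\<forall>b\<in>B. \<bar>c b - a b\<bar> \<le> \<epsilon>) \<and> h i0 p x - h i0 p y = (\<Sum>b\<in>B. c b * (h b p x - h b p y)))"
    using constant_rank_dependence[of "I0 \<union> C" B i0 h gh p0 x0 D a \<epsilon>] deriv cont inj ind spB rank va \<epsilon>0 JI0 i0 finI0 finC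
    unfolding B_def v_def by blast
  \<comment> \<open>\<open>N - 1\<close> bounds the total weight on \<open>J\<close>; the extra 1
    makes the final estimate strict.\<close>
  define N where "N = (\<Sum>b\<in>J. \<bar>a b\<bar> + 1) + 1"
  have N: "1 \<le> N" unfolding N_def by (simp add: sum_nonneg)
  define r where "r = min R (1/N)"
  have r: "0 < r" "r \<le> R" "r * N \<le> 1" using R N by (auto simp: r_def min_def field_simps)
  have "\<exists>j\<in>J. r * t < \<bar>h j p x\<bar>"
    if px: "p \<in> D" "dist p p0 < r" "dist x x0 < r" "dist y x0 < r"
      and y: "\<forall>i\<in>C. h i p y \<le> 0" "\<forall>j\<in>I0. h j p y = 0"
      and t: "0 < t" "\<forall>i\<in>C. t \<le> h i p x" for p x y t
  proof (rule ccontr)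
    assume "\<not> ?thesis"
    then have small: "\<And>j. j \<in> J \<Longrightarrow> \<bar>h j p x\<bar> \<le> r * t" by force
    obtain c where c: "\<And>b. b \<in> B \<Longrightarrow> \<bar>c b - a b\<bar> \<le> \<epsilon>"
      "h i0 p x - h i0 p y = (\<Sum>b\<in>B. c b * (h b p x - h b p y))"
      using dp[of p x y] px r(2) by force
    \<comment> \<open>From \<open>y\<close> to \<open>x\<close> the value of \<open>h i0\<close>
      rises by at least \<open>t\<close>. The other circuit members rise too, but with nonpositive
      coefficients, so the rise would have to come from \<open>J\<close>, whose values are too
      small.\<close>
    have "t \<le> h i0 p x - h i0 p y" using t(2) y(1) i0 by force
    also have "\<dots> = (\<Sum>b\<in>J. c b * (h b p x - h b p y)) + (\<Sum>b\<in>C - {i0}. c b * (h b p x - h b p y))"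
      unfolding c(2) B_def using dJ finJ finC by (subst sum.union_disjoint) auto
    also have "(\<Sum>b\<in>C - {i0}. c b * (h b p x - h b p y)) \<le> 0"
    proof (intro sum_nonpos mult_nonpos_nonneg)
      fix b assume b: "b \<in> C - {i0}"
      show "c b \<le> 0" using c(1)[of b] \<epsilon>a[OF b] b by (auto simp: B_def)
      show "0 \<le> h b p x - h b p y" using t y(1) b by force
    qed
    also have "(\<Sum>b\<in>J. c b * (h b p x - h b p y)) \<le> (\<Sum>b\<in>J. (\<bar>a b\<bar> + 1) * (r * t))"
    proof (rule sum_mono)
      fix b assume b: "b \<in> J"
      have "c b * (h b p x - h b p y) \<le> \<bar>c b * h b p x\<bar>" using b JI0 y(2) by auto
      also have "\<dots> \<le> (\<bar>a b\<bar> + 1) * (r * t)"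
        unfolding abs_mult using c(1)[of b] b \<epsilon>1 small[OF b] by (intro mult_mono) (auto simp: B_def)
      finally show "c b * (h b p x - h b p y) \<le> (\<bar>a b\<bar> + 1) * (r * t)" .
    qed
    also have "(\<Sum>b\<in>J. (\<bar>a b\<bar> + 1) * (r * t)) = (N - 1) * (r * t)"
      by (simp add: N_def sum_distrib_right)
    finally have "t \<le> (N - 1) * (r * t)" by simp
    also have "\<dots> = (r * N) * t - r * t" by (simp add: algebra_simps)
    also have "\<dots> \<le> 1 * t - r * t" using r(3) t(1) by (intro diff_right_mono mult_right_mono) auto
    also have "\<dots> < t" using r(1) t(1) by simp
    finally show False by simp
  qed
  then show ?thesis using r(1) by blast
qed

lemma finite_uniform_radius:
  fixes Q :: "'s \<Rightarrow> real \<Rightarrow> bool"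
  assumes "finite S" and "\<And>s. s \<in> S \<Longrightarrow> \<exists>r>0. Q s r"
    and mono: "\<And>s r r'. Q s r \<Longrightarrow> 0 < r' \<Longrightarrow> r' \<le> r \<Longrightarrow> Q s r'"
  shows "\<exists>r>0. \<forall>s\<in>S. Q s r"
  using assms(1,2)
proof (induction S rule: finite_induct)
  case empty
  show ?case by (rule exI[of _ 1]) simp
next
  case (insert s S)
  obtain r where r: "0 < r" "\<forall>s\<in>S. Q s r" using insert by auto
  obtain r' where r': "0 < r'" "Q s r'" using insert by auto
  have "\<forall>s\<in>insert s S. Q s (min r r')"
    using r r' by (auto intro: mono[of _ r] mono[of _ r'])
  then show ?case using r(1) r'(1) by (intro exI[of _ "min r r'"]) auto
qed

text \<open>The dependence contains a circuit \<open>C \<subseteq> A\<close>, and the conditions at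
  \<open>x\<close> and \<open>y\<close> restrict from \<open>A\<close> to \<open>C\<close>. Which
  subset arises is not known beforehand, so constant rank is asked for all of them, as RCRCQ
  provides.\<close>

lemma positively_dependent_infeasible:
  fixes h :: "'i \<Rightarrow> 'p::metric_space \<Rightarrow> 'x::{real_inner,complete_space} \<Rightarrow> real"
  assumes finI0: "finite I0" and JI0: "J \<subseteq> I0" and finA: "finite A" and disj: "A \<inter> I0 = {}"
    and deriv: "\<And>i p x. i \<in> I0 \<union> A \<Longrightarrow> (h i p has_derivative (\<lambda>w. gh i p x \<bullet> w)) (at x)"
    and cont: "\<And>i. i \<in> I0 \<union> A \<Longrightarrow> isCont (\<lambda>(p, x). gh i p x) (p0, x0)"
    and J: "inj_on (\<lambda>i. gh i p0 x0) J" "independent ((\<lambda>i. gh i p0 x0) ` J)"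
    and sp: "(\<lambda>i. gh i p0 x0) ` I0 \<subseteq> span ((\<lambda>i. gh i p0 x0) ` J)"
    and rank: "\<And>C. C \<subseteq> A \<Longrightarrow> \<forall>\<^sub>F (p, x) in nhds (p0, x0). p \<in> D \<longrightarrow>
      dim ((\<lambda>i. gh i p x) ` (I0 \<union> C)) = dim ((\<lambda>i. gh i p0 x0) ` (I0 \<union> C))"
    and nonneg: "\<And>i. i \<in> A \<Longrightarrow> (0::real) \<le> \<nu> i" and pos: "i \<in> A" "0 < \<nu> i"
    and dep: "(\<Sum>i\<in>A. \<nu> i *\<^sub>R gh i p0 x0) \<in> span ((\<lambda>i. gh i p0 x0) ` J)"
  shows "\<exists>r>0. \<forall>p x y t. p \<in> D \<longrightarrow> dist p p0 < r \<longrightarrow> dist x x0 < r \<longrightarrow> dist y x0 < r \<longrightarrow>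
    (\<forall>i\<in>A. h i p y \<le> 0) \<longrightarrow> (\<forall>j\<in>I0. h j p y = 0) \<longrightarrow> 0 < t \<longrightarrow> (\<forall>i\<in>A. t \<le> h i p x) \<longrightarrow>
    (\<exists>j\<in>J. r * t < \<bar>h j p x\<bar>)"
proof -
  have finJ: "finite J" using JI0 finI0 by (rule finite_subset)
  have "A \<inter> J = {}" using disj JI0 by blast
  from positive_circuit_exists[OF finA finJ this J nonneg pos dep]
  obtain C i0 \<kappa> where C: "C \<subseteq> A" "i0 \<in> C" "\<And>i. i \<in> C \<Longrightarrow> (0::real) < \<kappa> i"
      "(\<Sum>i\<in>C. \<kappa> i *\<^sub>R gh i p0 x0) \<in> span ((\<lambda>i. gh i p0 x0) ` J)"
      "inj_on (\<lambda>i. gh i p0 x0) (J \<union> (C - {i0}))" "independent ((\<lambda>i. gh i p0 x0) ` (J \<union> (C - {i0})))"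
    by blast
  have "finite C" "C \<inter> I0 = {}" using C(1) finA disj finite_subset by auto
  then have "\<exists>r>0. \<forall>p x y t. p \<in> D \<longrightarrow> dist p p0 < r \<longrightarrow> dist x x0 < r \<longrightarrow> dist y x0 < r \<longrightarrow>
    (\<forall>i\<in>C. h i p y \<le> 0) \<longrightarrow> (\<forall>j\<in>I0. h j p y = 0) \<longrightarrow> 0 < t \<longrightarrow> (\<forall>i\<in>C. t \<le> h i p x) \<longrightarrow>
    (\<exists>j\<in>J. r * t < \<bar>h j p x\<bar>)"
    using C(1) deriv cont
    by (intro circuit_infeasible[OF finI0 JI0 _ _ C(2) _ _ C(5,6) sp rank[OF C(1)] C(3,4)]) auto
  then obtain r where r: "0 < r" "\<forall>p x y t. p \<in> D \<longrightarrow> dist p p0 < r \<longrightarrow> dist x x0 < r \<longrightarrow> dist y x0 < r \<longrightarrow>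
    (\<forall>i\<in>C. h i p y \<le> 0) \<longrightarrow> (\<forall>j\<in>I0. h j p y = 0) \<longrightarrow> 0 < t \<longrightarrow> (\<forall>i\<in>C. t \<le> h i p x) \<longrightarrow>
    (\<exists>j\<in>J. r * t < \<bar>h j p x\<bar>)"
    by (elim exE conjE) (rule that)
  show ?thesis
  proof (rule exI[of _ r], intro conjI allI impI r(1))
    fix p x y t
    assume "p \<in> D" "dist p p0 < r" "dist x x0 < r" "dist y x0 < r"
      "\<forall>i\<in>A. h i p y \<le> 0" "\<forall>j\<in>I0. h j p y = 0" "0 < t" "\<forall>i\<in>A. t \<le> h i p x"
    then show "\<exists>j\<in>J. r * t < \<bar>h j p x\<bar>"
      using C(1) r(2)[rule_format, of p x y t] by blast
  qed
qed

text \<open>The number \<open>c\<close> is both radius and rate, so the conclusion survives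
  shrinking it and finitely many sets of pieces can share one value. The direction depends on the
  set only, not on the point.\<close>

lemma common_descent_direction_nearby:
  fixes G :: "'l \<Rightarrow> 'p::metric_space \<Rightarrow> 'x::real_inner \<Rightarrow> 'x"
  assumes fin: "finite \<Lambda>" and ne: "\<Lambda> \<noteq> {}"
    and cont: "\<And>l. l \<in> \<Lambda> \<Longrightarrow> isCont (\<lambda>(p, x). G l p x) (p0, x0)"
    and d: "\<forall>l\<in>\<Lambda>. G l p0 x0 \<bullet> d < 0"
  shows "\<exists>c>0. \<exists>d. d \<noteq> 0 \<and> norm d \<le> 1 \<and>
    (\<forall>l\<in>\<Lambda>. \<forall>p x. dist p p0 < c \<longrightarrow> dist x x0 < c \<longrightarrow> G l p x \<bullet> d < - c)"
proof -
  define e where "e = d /\<^sub>R norm d"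
  have d0: "d \<noteq> 0" using d ne by auto
  have e: "e \<noteq> 0" "norm e \<le> 1" using d0 by (auto simp: e_def)
  have neg: "G l p0 x0 \<bullet> e < 0" if "l \<in> \<Lambda>" for l
    using d that d0 by (auto simp: e_def mult_pos_neg)
  have "\<exists>c>0. \<forall>l\<in>\<Lambda>. \<forall>p x. dist p p0 < c \<longrightarrow> dist x x0 < c \<longrightarrow> G l p x \<bullet> e < - c"
  proof (rule finite_uniform_radius[OF fin])
    fix l assume l: "l \<in> \<Lambda>"
    define k where "k = - (G l p0 x0 \<bullet> e) / 2"
    have k: "0 < k" "G l p0 x0 \<bullet> e < - k" using neg[OF l] by (auto simp: k_def)
    have "((\<lambda>q. (case q of (p, x) \<Rightarrow> G l p x) \<bullet> e) \<longlongrightarrow> (case (p0, x0) of (p, x) \<Rightarrow> G l p x) \<bullet> e) (nhds (p0, x0))"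
      using cont[OF l] unfolding isCont_def tendsto_at_iff_tendsto_nhds by (intro tendsto_intros)
    then have "\<forall>\<^sub>F q in nhds (p0, x0). (case q of (p, x) \<Rightarrow> G l p x) \<bullet> e < - k"
      by (rule order_tendstoD) (use k in simp)
    from eventually_nhds_Pair_dist[OF this] obtain r where r: "0 < r"
      "\<And>p x. dist p p0 < r \<Longrightarrow> dist x x0 < r \<Longrightarrow> G l p x \<bullet> e < - k" by auto
    show "\<exists>c>0. \<forall>p x. dist p p0 < c \<longrightarrow> dist x x0 < c \<longrightarrow> G l p x \<bullet> e < - c"
      using r k by (intro exI[of _ "min r k"]) fastforce
  next
    show "\<forall>p x. dist p p0 < c' \<longrightarrow> dist x x0 < c' \<longrightarrow> G l p x \<bullet> e < - c'"
      if "\<forall>p x. dist p p0 < c \<longrightarrow> dist x x0 < c \<longrightarrow> G l p x \<bullet> e < - c" "0 < c'" "c' \<le> c" for l c c'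
      using that by (meson less_le_trans neg_le_iff_le)
  qed
  then show ?thesis using e by blast
qed

section \<open>R-regularity\<close>

theorem theorem14:
  fixes h :: "nat \<Rightarrow> 'p::real_normed_vector \<Rightarrow> 'x::{real_inner, complete_space} \<Rightarrow> real"
    and gh :: "nat \<Rightarrow> 'p \<Rightarrow> 'x \<Rightarrow> 'x"
    and m n :: nat and p0 :: 'p and x0 :: 'x
  assumes mn: "m \<le> n"
    and h_cont: "\<And>i. i \<in> {1..n} \<Longrightarrow> continuous_on UNIV (\<lambda>(p, x). h i p x)"
    and h_grad: "\<And>i p x. i \<in> {1..n} \<Longrightarrow>
                   ((\<lambda>y. h i p y) has_derivative (\<lambda>v. gh i p x \<bullet> v)) (at x)"
    and gh_cont: "\<And>i. i \<in> {1..n} \<Longrightarrow> continuous_on UNIV (\<lambda>(p, x). gh i p x)"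
    and in_graph: "(p0, x0) \<in> graph_sv (feas h m n)"
    and lsc: "lsc_rel (feas h m n) (dom_sv (feas h m n)) p0 x0"
    and rcrcq: "RCRCQ h gh m n (dom_sv (feas h m n)) UNIV p0 x0"
  shows "R_regular h m n (dom_sv (feas h m n)) p0 x0"
proof -
  define D where "D = dom_sv (feas h m n)"
  define I0 where "I0 = eqI0 m n"
  define Ia where "Ia = active h m p0 x0"
  define v where "v i = gh i p0 x0" for i
  have finI0: "finite I0" and finIa: "finite Ia" and disj: "Ia \<inter> I0 = {}"
    and IaI: "Ia \<subseteq> ineqI m" and I0n: "I0 \<subseteq> {1..n}" and In: "ineqI m \<subseteq> {1..n}"
    using mn by (auto simp: I0_def Ia_def eqI0_def active_def ineqI_def)
  have Ian: "Ia \<subseteq> {1..n}" using IaI In by blast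
  have Ia0: "h i p0 x0 = 0" if "i \<in> Ia" for i using that by (simp add: Ia_def active_def)
  have x0: "x0 \<in> feas h m n p0" using in_graph by (simp add: graph_sv_def)
  have gcont: "isCont (\<lambda>(p, x). gh i p x) (p0, x0)" if "i \<in> {1..n}" for i
    using gh_cont[OF that] by (simp add: continuous_on_eq_continuous_at)
  have hcont: "((\<lambda>q. h i (fst q) (snd q)) \<longlongrightarrow> h i p0 x0) (nhds (p0, x0))" if "i \<in> {1..n}" for i
  proof -
    have "isCont (\<lambda>q. h i (fst q) (snd q)) (p0, x0)"
      using h_cont[OF that] by (simp add: continuous_on_eq_continuous_at case_prod_beta)
    then show ?thesis using tendsto_at_iff_tendsto_nhds[of "\<lambda>q. h i (fst q) (snd q)" "(p0, x0)"]
      by (simp add: isCont_def)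
  qed
  have rank: "\<forall>\<^sub>F (p, x) in nhds (p0, x0). p \<in> D \<longrightarrow>
      dim ((\<lambda>i. gh i p x) ` (I0 \<union> C)) = dim ((\<lambda>i. gh i p0 x0) ` (I0 \<union> C))" if "C \<subseteq> Ia" for C
  proof -
    have "\<exists>U. open U \<and> (p0, x0) \<in> U \<and> (\<forall>(p, x)\<in>U \<inter> (D \<times> UNIV).
        dim ((\<lambda>i. gh i p x) ` (I0 \<union> C)) = dim ((\<lambda>i. gh i p0 x0) ` (I0 \<union> C)))"
      using rcrcq that unfolding RCRCQ_def rank_fam_def D_def I0_def Ia_def by simp
    then show ?thesis unfolding eventually_nhds by (elim ex_forward) auto
  qed
  obtain T where T: "T \<subseteq> v ` I0" "independent T" "v ` I0 \<subseteq> span T"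
    using maximal_independent_subset[of "v ` I0"] by blast
  then obtain J where J: "J \<subseteq> I0" "inj_on v J" "T = v ` J" using subset_image_inj[of T v I0] by auto
  have indJ: "independent (v ` J)" and spJ: "v ` I0 \<subseteq> span (v ` J)" using T J by auto
  have finJ: "finite J" using J(1) finI0 by (rule finite_subset)
  have Jn: "J \<subseteq> {1..n}" using J(1) I0n by blast
  have J0: "h j p0 x0 = 0" if "j \<in> J" for j using that x0 J(1) by (auto simp: feas_def I0_def)

  \<comment> \<open>Positively dependent sets of active inequalities\<close>
  define Q where "Q A r \<longleftrightarrow> (\<forall>p x y t. p \<in> D \<longrightarrow> dist p p0 < r \<longrightarrow> dist x x0 < r \<longrightarrow> dist y x0 < r \<longrightarrow>
    (\<forall>i\<in>A. h i p y \<le> 0) \<longrightarrow> (\<forall>j\<in>I0. h j p y = 0) \<longrightarrow> 0 < t \<longrightarrow> (\<forall>i\<in>A. t \<le> h i p x) \<longrightarrow>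
    (\<exists>j\<in>J. r * t < \<bar>h j p x\<bar>))" for A r
  define posdep where "posdep A \<longleftrightarrow> (\<exists>\<nu>. (\<forall>i\<in>A. 0 \<le> \<nu> i) \<and> (\<exists>i\<in>A. 0 < \<nu> i) \<and>
    (\<Sum>i\<in>A. \<nu> i *\<^sub>R v i) \<in> span (v ` J))" for A
  \<comment> \<open>Which inequalities attain the merit value will vary with the point, but there
    are finitely many subsets of \<open>Ia\<close>, so one \<open>r1\<close> serves them
    all.\<close>
  have "\<exists>r>0. \<forall>A\<in>{A. A \<subseteq> Ia \<and> posdep A}. Q A r"
  proof (rule finite_uniform_radius)
    show "finite {A. A \<subseteq> Ia \<and> posdep A}" using finIa by simp
    show "Q A r'" if "Q A r" "0 < r'" "r' \<le> r" for A r r'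
    proof -
      show ?thesis unfolding Q_def
      proof (intro allI impI)
        fix p x y t
        assume a: "p \<in> D" "dist p p0 < r'" "dist x x0 < r'" "dist y x0 < r'"
          "\<forall>i\<in>A. h i p y \<le> 0" "\<forall>j\<in>I0. h j p y = 0" "0 < t" "\<forall>i\<in>A. t \<le> h i p x"
        then have "\<exists>j\<in>J. r * t < \<bar>h j p x\<bar>"
          using that by (intro \<open>Q A r\<close>[unfolded Q_def, rule_format, of p x y t]) auto
        moreover have "r' * t \<le> r * t" using a(7) that(3) by simp
        ultimately show "\<exists>j\<in>J. r' * t < \<bar>h j p x\<bar>" by (meson le_less_trans)
      qed
    qed
    fix A assume "A \<in> {A. A \<subseteq> Ia \<and> posdep A}"
    then obtain \<nu> i where A: "A \<subseteq> Ia" and \<nu>: "\<forall>i\<in>A. 0 \<le> \<nu> i" "i \<in> A" "0 < \<nu> i"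
        "(\<Sum>i\<in>A. \<nu> i *\<^sub>R v i) \<in> span (v ` J)"
      unfolding posdep_def by blast
    have "finite A" "A \<inter> I0 = {}" "I0 \<union> A \<subseteq> {1..n}" using A finIa disj Ian I0n finite_subset by auto
    then show "\<exists>r>0. Q A r"
      unfolding Q_def using A \<nu> J(2) indJ spJ
      by (intro positively_dependent_infeasible[OF finI0 J(1), of A h gh p0 x0 D \<nu> i])
        (auto simp: v_def[abs_def] intro!: h_grad gcont rank)
  qed
  then obtain r1 where r1: "0 < r1" "\<And>A. A \<subseteq> Ia \<Longrightarrow> posdep A \<Longrightarrow> Q A r1" by auto

  \<comment> \<open>Equalities outside the basis\<close>
  have "\<exists>r>0. \<forall>j\<in>I0. \<forall>p x y. p \<in> D \<longrightarrow> dist p p0 < r \<longrightarrow> dist x x0 < r \<longrightarrow> dist y x0 < r \<longrightarrow>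
      (\<forall>j\<in>J. h j p x = h j p y) \<longrightarrow> h j p x = h j p y"
  proof (rule finite_uniform_radius[OF finI0])
    fix j assume j: "j \<in> I0"
    obtain a where a: "v j = (\<Sum>b\<in>J. a b *\<^sub>R v b)" using span_image_imp_sum[OF finJ] spJ j by blast
    \<comment> \<open>The tolerance 1 is arbitrary: when all increments over \<open>J\<close>
      vanish, so does that of \<open>h j\<close>, whatever the coefficients.\<close>
    have "\<exists>r>0. \<forall>p x y. p \<in> D \<longrightarrow> dist p p0 < r \<longrightarrow> dist x x0 < r \<longrightarrow> dist y x0 < r \<longrightarrow>
      (\<exists>c. (\<forall>b\<in>J. \<bar>c b - a b\<bar> \<le> 1) \<and> h j p x - h j p y = (\<Sum>b\<in>J. c b * (h b p x - h b p y)))"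
      using J(2) indJ spJ rank[of "{}"] a I0n
      by (intro constant_rank_dependence[OF finI0 J(1) j, of h gh p0 x0 D a 1])
        (auto simp: v_def[abs_def] intro!: h_grad gcont)
    then obtain r where r: "0 < r" "\<And>p x y. p \<in> D \<Longrightarrow> dist p p0 < r \<Longrightarrow> dist x x0 < r \<Longrightarrow> dist y x0 < r \<Longrightarrow>
      (\<exists>c. h j p x - h j p y = (\<Sum>b\<in>J. c b * (h b p x - h b p y)))"
      by blast
    have "h j p x = h j p y" if px: "p \<in> D" "dist p p0 < r" "dist x x0 < r" "dist y x0 < r"
      and eq: "\<forall>j\<in>J. h j p x = h j p y" for p x y
      using r(2)[OF px] eq by auto
    then show "\<exists>r>0. \<forall>p x y. p \<in> D \<longrightarrow> dist p p0 < r \<longrightarrow> dist x x0 < r \<longrightarrow> dist y x0 < r \<longrightarrow>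
      (\<forall>j\<in>J. h j p x = h j p y) \<longrightarrow> h j p x = h j p y"
      using r(1) by blast
  qed force
  then obtain r2 where r2: "0 < r2" "\<And>j p x y. j \<in> I0 \<Longrightarrow> p \<in> D \<Longrightarrow> dist p p0 < r2 \<Longrightarrow> dist x x0 < r2 \<Longrightarrow>
      dist y x0 < r2 \<Longrightarrow> (\<forall>j\<in>J. h j p x = h j p y) \<Longrightarrow> h j p x = h j p y" by blast

  \<comment> \<open>Inactive inequalities\<close>
  have "\<forall>\<^sub>F q in nhds (p0, x0). \<forall>i\<in>ineqI m - Ia. h i (fst q) (snd q) < 0"
  proof (intro eventually_ball_finite ballI)
    fix i assume i: "i \<in> ineqI m - Ia"
    then have "h i p0 x0 < 0" using x0 by (force simp: feas_def Ia_def active_def)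
    then show "\<forall>\<^sub>F q in nhds (p0, x0). h i (fst q) (snd q) < 0"
      using order_tendstoD(2)[OF hcont] i In by blast
  qed (simp add: ineqI_def)
  from eventually_nhds_Pair_dist[OF this] obtain r3 where r3: "0 < r3"
    "\<And>i p x. i \<in> ineqI m - Ia \<Longrightarrow> dist p p0 < r3 \<Longrightarrow> dist x x0 < r3 \<Longrightarrow> h i p x < 0" by auto

  \<comment> \<open>The merit function and its smooth pieces\<close>
  define N where "N = max 1 (1 / r1)"
  \<comment> \<open>The bound \<open>1 \<le> r1 * N\<close> turns
    \<open>r1 * f < \<bar>h_j\<bar>\<close> into a piece exceeding the maximum \<open>f\<close>;
    \<open>1 \<le> N\<close> lets \<open>N\<close> times the residual dominate the pieces of weight
    1 as well.\<close>
  have N: "1 \<le> N" "1 \<le> r1 * N" using r1(1) by (auto simp: N_def max_def field_simps)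
  \<comment> \<open>A piece is a constraint with a weight; splitting
    \<open>N * \<bar>h_j\<bar>\<close> into the weights \<open>N\<close> and \<open>- N\<close>
    keeps every piece differentiable.\<close>
  define L where "L = Ia \<times> {1} \<union> J \<times> {N, - N}"
  define g where "g l p x = snd l * h (fst l) p x" for l p x
  define G where "G l p x = snd l *\<^sub>R gh (fst l) p x" for l p x
  have finL: "finite L" using finIa finJ by (simp add: L_def)
  have Ln: "fst l \<in> {1..n}" if "l \<in> L" for l using that Ian Jn by (auto simp: L_def)
  have Gcont: "isCont (\<lambda>(p, x). G l p x) (p0, x0)" if "l \<in> L" for l
    using gcont[OF Ln[OF that]] unfolding G_def case_prod_beta by (intro continuous_intros)
  have gderiv: "(g l p has_derivative (\<lambda>w. G l p x \<bullet> w)) (at x)" if "l \<in> L" for l p x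
    using h_grad[OF Ln[OF that], of p x] unfolding g_def[abs_def] G_def
    by (auto intro!: derivative_eq_intros)
  define f where "f p x = Max (insert 0 ((\<lambda>l. g l p x) ` L))" for p x
  have g_le: "g l p x \<le> f p x" if "l \<in> L" for l p x using that finL by (simp add: f_def)

  \<comment> \<open>Uniform descent for sets of pieces\<close>
  define R where "R \<Lambda> c \<longleftrightarrow> (\<exists>d. d \<noteq> 0 \<and> norm d \<le> 1 \<and>
    (\<forall>l\<in>\<Lambda>. \<forall>p x. dist p p0 < c \<longrightarrow> dist x x0 < c \<longrightarrow> G l p x \<bullet> d < - c))" for \<Lambda> c
  define sep where "sep \<Lambda> \<longleftrightarrow> (\<exists>d. \<forall>l\<in>\<Lambda>. G l p0 x0 \<bullet> d < 0)" for \<Lambda>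
  have "\<exists>c>0. \<forall>\<Lambda>\<in>{\<Lambda>. \<Lambda> \<subseteq> L \<and> \<Lambda> \<noteq> {} \<and> sep \<Lambda>}. R \<Lambda> c"
  proof (rule finite_uniform_radius)
    show "finite {\<Lambda>. \<Lambda> \<subseteq> L \<and> \<Lambda> \<noteq> {} \<and> sep \<Lambda>}" using finL by simp
    show "R \<Lambda> c'" if "R \<Lambda> c" "0 < c'" "c' \<le> c" for \<Lambda> c c'
      using that unfolding R_def by (meson less_le_trans neg_le_iff_le)
    fix \<Lambda> assume "\<Lambda> \<in> {\<Lambda>. \<Lambda> \<subseteq> L \<and> \<Lambda> \<noteq> {} \<and> sep \<Lambda>}"
    then obtain d where \<Lambda>: "\<Lambda> \<subseteq> L" "\<Lambda> \<noteq> {}" "\<forall>l\<in>\<Lambda>. G l p0 x0 \<bullet> d < 0"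
      unfolding sep_def by blast
    have "finite \<Lambda>" using \<Lambda>(1) finL by (rule finite_subset)
    then show "\<exists>c>0. R \<Lambda> c" unfolding R_def
      using \<Lambda> Gcont by (intro common_descent_direction_nearby) auto
  qed
  then obtain c where c: "0 < c" "\<And>\<Lambda>. \<Lambda> \<subseteq> L \<Longrightarrow> \<Lambda> \<noteq> {} \<Longrightarrow> sep \<Lambda> \<Longrightarrow> R \<Lambda> c"
    by auto

  \<comment> \<open>Localisation and the final estimate\<close>
  define \<rho> where "\<rho> = Min {r1, r2, r3, c}"
  have \<rho>: "0 < \<rho>" "\<rho> \<le> r1" "\<rho> \<le> r2" "\<rho> \<le> r3" "\<rho> \<le> c" using r1 r2 r3 c by (auto simp: \<rho>_def)
  \<comment> \<open>A merit value below \<open>c * \<rho> / 2\<close> gives a search radius below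
    \<open>\<rho> / 2\<close>; centred within \<open>\<rho> / 2\<close> of \<open>x0\<close>, the
    search stays in the \<open>\<rho>\<close>-ball where all local facts hold.\<close>
  have "\<forall>\<^sub>F q in nhds (p0, x0). \<forall>l\<in>L. g l (fst q) (snd q) < c * \<rho> / 2"
  proof (intro eventually_ball_finite ballI finL)
    fix l assume l: "l \<in> L"
    have "((\<lambda>q. g l (fst q) (snd q)) \<longlongrightarrow> snd l * h (fst l) p0 x0) (nhds (p0, x0))"
      unfolding g_def by (intro tendsto_intros hcont Ln l)
    moreover have "snd l * h (fst l) p0 x0 < c * \<rho> / 2"
      using l c(1) \<rho>(1) Ia0 J0 by (auto simp: L_def)
    ultimately show "\<forall>\<^sub>F q in nhds (p0, x0). g l (fst q) (snd q) < c * \<rho> / 2"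
      by (rule order_tendstoD(2))
  qed
  from eventually_nhds_Pair_dist[OF this] obtain r4 where r4: "0 < r4"
    "\<And>l p x. l \<in> L \<Longrightarrow> dist p p0 < r4 \<Longrightarrow> dist x x0 < r4 \<Longrightarrow> g l p x < c * \<rho> / 2" by auto
  obtain W where W: "open W" "p0 \<in> W" "\<And>p. p \<in> W \<Longrightarrow> p \<in> D \<Longrightarrow> feas h m n p \<inter> ball x0 \<rho> \<noteq> {}"
    using lsc[unfolded lsc_rel_def, rule_format, of "ball x0 \<rho>"] \<rho>(1) unfolding D_def by auto

  have main: "infdist x (feas h m n p) \<le> N / c * resid h m n p x"
    if p: "p \<in> W" "p \<in> D" "dist p p0 < min r4 \<rho>" and x: "dist x x0 < min r4 (\<rho>/2)" for p x
  proof -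
    \<comment> \<open>One comparison point, chosen before any \<open>u\<close> is considered, serves
      the circuits and later the redundant equalities at \<open>z\<close>.\<close>
    obtain y where y: "y \<in> feas h m n p" "dist y x0 < \<rho>" using W(3)[OF p(1,2)] by (auto simp: dist_commute)
    have yI: "h i p y \<le> 0" if "i \<in> ineqI m" for i using y(1) that by (simp add: feas_def)
    have yJ: "h j p y = 0" if "j \<in> I0" for j using y(1) that by (simp add: feas_def I0_def)
    have "f p x < c * \<rho> / 2"
      unfolding f_def using r4(2)[of _ p x] p(3) x finL c(1) \<rho>(1) by (subst Max_less_iff) auto
    then have fx: "f p x / c < \<rho> / 2" using c(1) by (simp add: field_simps)
    have near: "dist u x0 < \<rho>" if "dist x u \<le> f p x / c" for u
      using that fx x dist_triangle[of u x0 x] dist_commute[of u x] by linarith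
    have descent: "\<exists>d. d \<noteq> 0 \<and> norm d \<le> 1 \<and> (\<forall>l\<in>L. g l p u = f p u \<longrightarrow> G l p u \<bullet> d < - c)"
      if u: "dist x u \<le> f p x / c" "0 < f p u" for u
    proof -
      define \<Lambda> where "\<Lambda> = {l\<in>L. g l p u = f p u}"
      have \<Lambda>L: "\<Lambda> \<subseteq> L" and fin\<Lambda>: "finite \<Lambda>" using finL by (auto simp: \<Lambda>_def)
      have "f p u \<in> insert 0 ((\<lambda>l. g l p u) ` L)" unfolding f_def using finL by (intro Max_in) auto
      then obtain l where "l \<in> L" "g l p u = f p u" using u(2) by (metis imageE insertE less_irrefl)
      then have ne: "\<Lambda> \<noteq> {}" unfolding \<Lambda>_def by blast
      \<comment> \<open>Without a common descent direction Gordan's weights exist. Their inequality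
        part is a positive dependence modulo \<open>J\<close>, and comparison with \<open>y\<close>
        makes some \<open>h_j\<close> with \<open>j \<in> J\<close> too large for the value
        \<open>f p u\<close>.\<close>
      have "sep \<Lambda>"
      proof (rule ccontr)
        assume "\<not> sep \<Lambda>"
        from family_separation[OF fin\<Lambda> this[unfolded sep_def]]
        obtain \<mu> where \<mu>: "\<And>l. l \<in> \<Lambda> \<Longrightarrow> 0 \<le> \<mu> l" "sum \<mu> \<Lambda> = (1::real)" "(\<Sum>l\<in>\<Lambda>. \<mu> l *\<^sub>R G l p0 x0) = 0"
          by blast
        define A where "A = {i\<in>Ia. (i, 1) \<in> \<Lambda>}"
        define \<Lambda>J where "\<Lambda>J = \<Lambda> \<inter> J \<times> {N, - N}"
        have AIa: "A \<subseteq> Ia" and finA: "finite A" using finIa by (auto simp: A_def)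
        have \<Lambda>split: "\<Lambda> = (\<lambda>i. (i, 1)) ` A \<union> \<Lambda>J" "(\<lambda>i. (i, 1)) ` A \<inter> \<Lambda>J = {}"
          using \<Lambda>L disj J(1) by (auto simp: A_def \<Lambda>J_def L_def)
        have fin\<Lambda>J: "finite \<Lambda>J" using fin\<Lambda> by (simp add: \<Lambda>J_def)
        have inj1: "inj_on (\<lambda>i. (i, 1::real)) A" by (simp add: inj_on_def)
        have s0: "(\<Sum>i\<in>A. \<mu> (i, 1) *\<^sub>R v i) + (\<Sum>l\<in>\<Lambda>J. (\<mu> l * snd l) *\<^sub>R v (fst l)) = 0"
          using \<mu>(3) by (subst (asm) \<Lambda>split(1), subst (asm) sum.union_disjoint)
            (use finA fin\<Lambda>J \<Lambda>split(2) in \<open>auto simp: sum.reindex[OF inj1] G_def v_def\<close>)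
        have s1: "(\<Sum>i\<in>A. \<mu> (i, 1)) + sum \<mu> \<Lambda>J = 1"
          using \<mu>(2) by (subst (asm) \<Lambda>split(1), subst (asm) sum.union_disjoint)
            (use finA fin\<Lambda>J \<Lambda>split(2) in \<open>auto simp: sum.reindex[OF inj1]\<close>)
        have "posdep A"
        proof -
          have "(\<Sum>i\<in>A. \<mu> (i, 1) *\<^sub>R v i) = - (\<Sum>l\<in>\<Lambda>J. (\<mu> l * snd l) *\<^sub>R v (fst l))"
            using s0 by (simp add: add_eq_0_iff2)
          also have "\<dots> \<in> span (v ` J)"
            by (intro span_neg span_sum span_mul span_base) (auto simp: \<Lambda>J_def)
          finally have "(\<Sum>i\<in>A. \<mu> (i, 1) *\<^sub>R v i) \<in> span (v ` J)" .
          moreover have "\<forall>i\<in>A. 0 \<le> \<mu> (i, 1)" using \<mu>(1) by (auto simp: A_def)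
          \<comment> \<open>If all weight sat on equality pieces, independence would make the net
            coefficient \<open>\<beta> j\<close> of each \<open>h_j\<close> vanish. The weighted
            mean of the attained values, all equal to \<open>f p u > 0\<close>, would then be
            0.\<close>
          moreover have "\<exists>i\<in>A. 0 < \<mu> (i, 1)"
          proof (rule ccontr)
            assume "\<not> ?thesis"
            then have z: "\<mu> (i, 1) = 0" if "i \<in> A" for i using that \<mu>(1) by (force simp: A_def)
            define \<beta> where "\<beta> j = (\<Sum>l\<in>{l\<in>\<Lambda>J. fst l = j}. \<mu> l * snd l)" for j
            have "(\<Sum>j\<in>J. \<beta> j *\<^sub>R v j) = (\<Sum>j\<in>J. \<Sum>l\<in>{l\<in>\<Lambda>J. fst l = j}. (\<mu> l * snd l) *\<^sub>R v (fst l))"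
              by (auto simp: \<beta>_def scaleR_sum_left intro!: sum.cong)
            also have "\<dots> = (\<Sum>l\<in>\<Lambda>J. (\<mu> l * snd l) *\<^sub>R v (fst l))"
              by (rule sum.group) (use fin\<Lambda>J finJ in \<open>auto simp: \<Lambda>J_def\<close>)
            also have "\<dots> = 0" using s0 z by simp
            finally have \<beta>0: "\<beta> j = 0" if "j \<in> J" for j
              using independent_family_iff[OF finJ, of v] J(2) indJ that by blast
            have "f p u * sum \<mu> \<Lambda>J = (\<Sum>l\<in>\<Lambda>J. \<mu> l * snd l * h (fst l) p u)"
              unfolding sum_distrib_left
              by (intro sum.cong) (auto simp: \<Lambda>J_def \<Lambda>_def g_def mult_ac)
            also have "\<dots> = (\<Sum>j\<in>J. \<Sum>l\<in>{l\<in>\<Lambda>J. fst l = j}. \<mu> l * snd l * h (fst l) p u)"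
              by (rule sum.group[symmetric]) (use fin\<Lambda>J finJ in \<open>auto simp: \<Lambda>J_def\<close>)
            also have "\<dots> = (\<Sum>j\<in>J. \<beta> j * h j p u)"
              by (auto simp: \<beta>_def sum_distrib_right intro!: sum.cong)
            also have "\<dots> = 0" using \<beta>0 by simp
            finally show False using s1 z u(2) by simp
          qed
          ultimately show ?thesis unfolding posdep_def by (intro exI[of _ "\<lambda>i. \<mu> (i, 1)"] conjI)
        qed
        then have QA: "Q A r1" using r1(2) AIa by blast
        \<comment> \<open>The level \<open>t\<close> is the merit value itself, which every
          inequality in \<open>A\<close> attains with weight 1.\<close>
        have "\<exists>j\<in>J. r1 * f p u < \<bar>h j p u\<bar>"
        proof (rule QA[unfolded Q_def, rule_format, of p u y])
          show "p \<in> D" by (rule p(2))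
          show "dist p p0 < r1" "dist u x0 < r1" "dist y x0 < r1"
            using p(3) near[OF u(1)] y(2) \<rho>(2) by auto
          show "0 < f p u" by (rule u(2))
          show "h i p y \<le> 0" if "i \<in> A" for i using yI that AIa IaI by blast
          show "h j p y = 0" if "j \<in> I0" for j using yJ that .
          show "f p u \<le> h i p u" if "i \<in> A" for i using that by (simp add: A_def \<Lambda>_def g_def)
        qed
        then obtain j where j: "j \<in> J" "r1 * f p u < \<bar>h j p u\<bar>" by blast
        have "N * h j p u \<le> f p u" "- N * h j p u \<le> f p u"
          using g_le[of "(j, N)" p u] g_le[of "(j, - N)" p u] j(1) by (auto simp: g_def L_def)
        then have "N * \<bar>h j p u\<bar> \<le> f p u" by (simp add: abs_if)
        moreover have "N * (r1 * f p u) < N * \<bar>h j p u\<bar>" using j(2) N(1) by simp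
        moreover have "f p u \<le> N * (r1 * f p u)"
          using mult_right_mono[OF N(2), of "f p u"] u(2) by (simp add: mult_ac)
        ultimately show False by linarith
      qed
      from c(2)[OF \<Lambda>L ne this] obtain d where d: "d \<noteq> 0" "norm d \<le> 1"
        "\<And>l p x. l \<in> \<Lambda> \<Longrightarrow> dist p p0 < c \<Longrightarrow> dist x x0 < c \<Longrightarrow> G l p x \<bullet> d < - c"
        unfolding R_def by blast
      have "dist p p0 < c" "dist u x0 < c" using p(3) near[OF u(1)] \<rho>(5) by auto
      then show ?thesis using d by (intro exI[of _ d]) (auto simp: \<Lambda>_def)
    qed
    have "\<exists>z. (\<forall>l\<in>L. g l p z \<le> 0) \<and> dist x z \<le> f p x / c"
      by (rule max_family_error_bound[where g="\<lambda>l. g l p" and G="\<lambda>l. G l p" and f="f p", OF finL gderiv f_def c(1) descent])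
    then obtain z where z: "\<And>l. l \<in> L \<Longrightarrow> g l p z \<le> 0" "dist x z \<le> f p x / c" by blast
    have zn: "dist z x0 < \<rho>" by (rule near[OF z(2)])
    have zJ: "h j p z = 0" if "j \<in> J" for j
    proof -
      have "N * h j p z \<le> 0" "- N * h j p z \<le> 0"
        using z(1)[of "(j, N)"] z(1)[of "(j, - N)"] that by (auto simp: g_def L_def)
      then show ?thesis using N(1) by (auto simp: mult_le_0_iff zero_le_mult_iff)
    qed
    have "h j p z = 0" if j: "j \<in> I0" for j
    proof -
      \<comment> \<open>\<open>z\<close> and \<open>y\<close> agree on \<open>J\<close>, where both
        give 0, hence on all equalities.\<close>
      have "h j p z = h j p y"
        by (rule r2(2)[OF j p(2)]) (use p(3) zn y(2) \<rho>(3) zJ yJ J(1) in auto)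
      then show ?thesis using yJ[OF j] by simp
    qed
    moreover have "h i p z \<le> 0" if i: "i \<in> ineqI m" for i
    proof (cases "i \<in> Ia")
      case True
      then show ?thesis using z(1)[of "(i, 1)"] by (simp add: g_def L_def)
    next
      case False
      then show ?thesis using r3(2)[of i p z] i p(3) zn \<rho>(4) by auto
    qed
    ultimately have "z \<in> feas h m n p" by (auto simp: feas_def I0_def)
    then have "infdist x (feas h m n p) \<le> dist x z" by (rule infdist_le)
    also have "\<dots> \<le> f p x / c" by (rule z(2))
    \<comment> \<open>Each piece is at most \<open>N\<close> times the residual, whence the
      regularity constant \<open>N / c\<close>.\<close>
    also have "\<dots> \<le> N * resid h m n p x / c"
    proof (rule divide_right_mono)
      have finr: "finite ({0} \<union> (\<lambda>i. h i p x) ` ineqI m \<union> (\<lambda>i. \<bar>h i p x\<bar>) ` eqI0 m n)"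
        by (simp add: ineqI_def eqI0_def)
      have res: "0 \<le> resid h m n p x" "\<And>i. i \<in> ineqI m \<Longrightarrow> h i p x \<le> resid h m n p x"
          "\<And>j. j \<in> I0 \<Longrightarrow> \<bar>h j p x\<bar> \<le> resid h m n p x"
        unfolding resid_def I0_def by (intro Max_ge[OF finr]; auto)+
      have "g l p x \<le> N * resid h m n p x" if "l \<in> L" for l
      proof (cases "l \<in> Ia \<times> {1}")
        case True
        then have "g l p x \<le> 1 * resid h m n p x" using res(2) IaI by (auto simp: g_def)
        also have "\<dots> \<le> N * resid h m n p x" using N(1) res(1) by (intro mult_right_mono)
        finally show ?thesis .
      next
        case False
        then have l: "fst l \<in> J" "\<bar>snd l\<bar> = N" using that N(1) by (auto simp: L_def)
        have "g l p x \<le> \<bar>snd l\<bar> * \<bar>h (fst l) p x\<bar>" unfolding g_def abs_mult[symmetric] by simp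
        also have "\<dots> \<le> N * resid h m n p x"
          using l J(1) res(3) N(1) by (auto intro!: mult_left_mono)
        finally show ?thesis .
      qed
      then show "f p x \<le> N * resid h m n p x"
        unfolding f_def using finL N(1) res(1) by (subst Max_le_iff) auto
      show "0 \<le> c" using c(1) by simp
    qed
    finally show ?thesis by simp
  qed
  have "0 < N / c" using N(1) c(1) by simp
  moreover have "open (W \<inter> ball p0 (min r4 \<rho>))" "p0 \<in> W \<inter> ball p0 (min r4 \<rho>)"
    "open (ball x0 (min r4 (\<rho>/2)))" "x0 \<in> ball x0 (min r4 (\<rho>/2))"
    using W r4(1) \<rho>(1) by auto
  moreover have "\<forall>x\<in>ball x0 (min r4 (\<rho>/2)). \<forall>p\<in>W \<inter> ball p0 (min r4 \<rho>) \<inter> D.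
      infdist x (feas h m n p) \<le> N / c * resid h m n p x"
    using main by (simp add: dist_commute)
  ultimately show ?thesis unfolding R_regular_def D_def by blast
qed

end
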